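(* Let $(\Omega,\Sigma,\mathbb{P})$ be a probability space, let $\mathcal{X},\mathcal{Y}$ be real Banach spaces, and let $\leq$ be any binary relation on $\mathcal{Y}$ (the canonical total order if $\mathcal{Y}=\mathbb{R}$), extended to $\overline{\mathcal{Y}}=\mathcal{Y}\cup\{\pm\infty\}$. Let $\mathcal{F}\subseteq\Sigma$ be a sub-$\sigma$-algebra. Let $K\subseteq\mathcal{X}$, $f\colon K\to\mathcal{Y}$, and let $X\colon\Omega\to K$ be a random variable such that the pair $(X,f(X))$ is Bochner integrable. Let $g_l,g_u\colon\overline{\operatorname{Conv}(K)}\to\overline{\mathcal{Y}}$ be functions such that $$\overline{\operatorname{Conv}(\mathcal{G}(f))}\subseteq\{(x,y)\in\overline{\operatorname{Conv}(K)}\times\mathcal{Y} \mid g_l(x)\leq y\leq g_u(x)\},$$ i.e. $\overline{\operatorname{Conv}(\mathcal{G}(f))}|_x\subseteq[g_l(x),g_u(x)]$ for each $x\in\overline{\operatorname{Conv}(K)}$. Then $$g_l(\mathbb{E}[X|\mathcal{F}])\leq\mathbb{E}[f(X)|\mathcal{F}]\leq g_u(\mathbb{E}[X|\mathcal{F}])\quad\mathbb{P}\text{-almost surely}.$$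
   Context: Notation: $f(X)$ denotes $f\circ X$. $\mathbb{E}[\,\cdot\,|\mathcal{F}]$ denotes the conditional expectation of Bochner integrable Banach-space-valued random variables given $\mathcal{F}$. $\overline{A}$ is the closure, $\operatorname{Conv}(A)$ the convex hull of $A$; $\mathcal{G}(f)=\{(x,f(x))\mid x\in K\}$ is the graph of $f$. For $M\subseteq\mathcal{X}\times\mathcal{Y}$ and $x\in\mathcal{X}$, $M|_x:=\{y\in\mathcal{Y}\mid(x,y)\in M\}$; $\overline{\operatorname{Conv}(\mathcal{G}(f))}|_x$ is the section of the closed set $\overline{\operatorname{Conv}(\mathcal{G}(f))}$. The elements $\pm\infty$ of $\overline{\mathcal{Y}}$ satisfy $-\infty\leq y\leq\infty$ for each $y\in\mathcal{Y}$, and $[a,b]:=\{y\in\overline{\mathcal{Y}}\mid a\leq y\leq b\}$. *)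

theory Defs
  imports "HOL-Probability.Probability" "HOL-Library.Extended"
begin

text \<open>
  The library's Bochner integral (\<^const>\<open>has_bochner_integral\<close>, \<^const>\<open>integrable\<close>) and its
  measurability theory are restricted to second-countable, i.e. separable, target spaces.
  Since arbitrary Banach spaces are needed, the same notions are set up here without that
  restriction. Measurability of the integrand is replaced by strong measurability (being an
  almost everywhere limit of simple functions), so an integrand may be altered on a null set.
\<close>

definition strongly_measurable :: "'a measure \<Rightarrow> ('a \<Rightarrow> 'b::real_normed_vector) \<Rightarrow> bool" where
  "strongly_measurable M f \<longleftrightarrow>
     (\<exists>s. (\<forall>i::nat. simple_function M (s i)) \<and> (AE w in M. (\<lambda>i. s i w) \<longlonglongrightarrow> f w))"

definition bochner_has_integral ::
  "'a measure \<Rightarrow> ('a \<Rightarrow> 'b::real_normed_vector) \<Rightarrow> 'b \<Rightarrow> bool" where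
  "bochner_has_integral M f x \<longleftrightarrow> strongly_measurable M f \<and>
     (\<exists>s. (\<forall>i::nat. Bochner_Integration.simple_bochner_integrable M (s i)) \<and>
          (\<lambda>i. \<integral>\<^sup>+w. norm (f w - s i w) \<partial>M) \<longlonglongrightarrow> 0 \<and>
          (\<lambda>i. Bochner_Integration.simple_bochner_integral M (s i)) \<longlonglongrightarrow> x)"

definition bochner_integrable :: "'a measure \<Rightarrow> ('a \<Rightarrow> 'b::real_normed_vector) \<Rightarrow> bool" where
  "bochner_integrable M f \<longleftrightarrow> (\<exists>x. bochner_has_integral M f x)"

definition bochner_integral :: "'a measure \<Rightarrow> ('a \<Rightarrow> 'b::real_normed_vector) \<Rightarrow> 'b" where
  "bochner_integral M f =
     (if bochner_integrable M f then THE x. bochner_has_integral M f x else 0)"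

lemma bochner_has_integral_iff_has_bochner_integral:
  fixes f :: "'a \<Rightarrow> 'b::{real_normed_vector, second_countable_topology}"
  assumes f: "f \<in> borel_measurable M"
  shows "bochner_has_integral M f x \<longleftrightarrow> has_bochner_integral M f x"
proof
  assume "bochner_has_integral M f x"
  then show "has_bochner_integral M f x"
    using f unfolding bochner_has_integral_def by (auto intro: has_bochner_integral.intros)
next
  assume *: "has_bochner_integral M f x"
  obtain s where "\<And>i. simple_function M (s i)" "\<And>w. w \<in> space M \<Longrightarrow> (\<lambda>i. s i w) \<longlonglongrightarrow> f w"
    using borel_measurable_implies_sequence_metric[OF f] by metis
  then have "strongly_measurable M f"
    unfolding strongly_measurable_def by (intro exI[of _ s]) auto
  with * show "bochner_has_integral M f x"
    unfolding bochner_has_integral_def by (auto elim!: has_bochner_integral.cases)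
qed

text \<open>
  A version of the conditional expectation: measurable and Bochner integrable with respect to
  the restriction of \<open>M\<close> to \<open>F\<close>, with the same integrals as \<open>f\<close> over all sets in \<open>F\<close>.
  Versions are unique up to null sets, and \<open>bochner_cond_exp\<close> chooses one; its defining property
  is only available once existence of a version has been proved.
\<close>

definition is_cond_exp ::
  "'a measure \<Rightarrow> 'a measure \<Rightarrow> ('a \<Rightarrow> 'b::banach) \<Rightarrow> ('a \<Rightarrow> 'b) \<Rightarrow> bool" where
  "is_cond_exp M F f g \<longleftrightarrow>
     g \<in> borel_measurable F \<and> bochner_integrable (restr_to_subalg M F) g \<and>
     (\<forall>A\<in>sets F. bochner_integral M (\<lambda>w. indicator A w *\<^sub>R g w)
               = bochner_integral M (\<lambda>w. indicator A w *\<^sub>R f w))"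

definition bochner_cond_exp ::
  "'a measure \<Rightarrow> 'a measure \<Rightarrow> ('a \<Rightarrow> 'b::banach) \<Rightarrow> 'a \<Rightarrow> 'b" where
  "bochner_cond_exp M F f = (SOME g. is_cond_exp M F f g)"

definition graph_on :: "'x set \<Rightarrow> ('x \<Rightarrow> 'y) \<Rightarrow> ('x \<times> 'y) set" where
  "graph_on K f = {(x, f x) | x. x \<in> K}"

text \<open>
  \<^typ>\<open>'y extended\<close> adjoins \<^const>\<open>Minf\<close> and \<^const>\<open>Pinf\<close>. The order instance of that type requires
  an order on \<open>'y\<close>, so the extended relation is a separate argument here. How it relates
  the infinite elements with each other, and whether it holds for \<open>(Pinf, Fin y)\<close> or
  \<open>(Fin y, Minf)\<close>, is left open.
\<close>

definition extends_rel ::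
  "('y \<Rightarrow> 'y \<Rightarrow> bool) \<Rightarrow> ('y extended \<Rightarrow> 'y extended \<Rightarrow> bool) \<Rightarrow> bool" where
  "extends_rel le le' \<longleftrightarrow>
     (\<forall>a b. le' (Fin a) (Fin b) \<longleftrightarrow> le a b) \<and>
     (\<forall>y. le' Minf (Fin y) \<and> le' (Fin y) Pinf)"

end

theory Submission
  imports Defs
begin

text \<open>
  The pair \<open>Z = (X, f(X))\<close> takes its values in \<open>C\<close>, the closed convex hull of the graph of \<open>f\<close>.
  It suffices that a Bochner integrable \<open>Z\<close> with values in a closed convex set \<open>C\<close> has a version of
  its conditional expectation with values in \<open>C\<close> almost surely
  (\<open>cond_exp_in_closed_convex\<close>): the two components of such a version are versions
  of the conditional expectations of \<open>X\<close> and \<open>f(X)\<close>, versions are almost surely unique, and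
  membership in \<open>C\<close> is turned into the claimed bounds by the hypothesis on \<open>g\<^sub>l\<close> and \<open>g\<^sub>u\<close>.

  No Hahn-Banach separation is needed. Moving the values of a simple \<open>L\<^sup>1\<close> approximation of \<open>Z\<close>
  to nearly closest points of \<open>C\<close> at most about doubles the error, because \<open>Z\<close> itself lies in \<open>C\<close>.
  Hence \<open>Z\<close> is an \<open>L\<^sup>1\<close> limit of simple functions \<open>s\<^sub>n\<close> with values in \<open>C\<close>
  (\<open>simple_approx_in_set\<close>). For a simple function \<open>s\<close>, the sum over its values \<open>v\<close> of
  \<open>P(s = v | F) v\<close> is a version of the conditional expectation, and it is almost surely a convex
  combination of the values (\<open>cond_exp_version_simple_convex\<close>). Conditional expectation is a
  contraction in \<open>L\<^sup>1\<close> (\<open>cond_exp_version_contraction\<close>), so the versions for a fast converging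
  sequence \<open>s\<^sub>n\<close> converge in \<open>L\<^sup>1\<close> and almost surely (\<open>l1_complete\<close>); the limit is a version for
  \<open>Z\<close>, and it stays in the closed set \<open>C\<close>.

  The contraction also yields uniqueness. It is proved for any version \<open>g\<close> of the conditional
  expectation of \<open>h\<close> by approximating \<open>g\<close> with \<open>F\<close>-measurable simple functions: on each level set
  of such a function the integrals of \<open>g\<close> and \<open>h\<close> agree.

  The target spaces need not be separable, so sums of Borel functions need not be Borel. The
  calculus below is therefore carried out for strongly measurable functions, and a Borel measurable
  version of the conditional expectation is chosen only at the end.
\<close>

section \<open>Strong measurability\<close>

lemma strongly_measurable_simple_function:
  "simple_function M f \<Longrightarrow> strongly_measurable M f"
  unfolding strongly_measurable_def by (intro exI[of _ "\<lambda>_. f"]) auto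

lemma strongly_measurable_cong_AE:
  assumes "strongly_measurable M f" "AE w in M. f w = g w"
  shows "strongly_measurable M g"
proof -
  obtain s where s: "\<And>i. simple_function M (s i)" "AE w in M. (\<lambda>i. s i w) \<longlonglongrightarrow> f w"
    using assms(1) unfolding strongly_measurable_def by auto
  have "AE w in M. (\<lambda>i. s i w) \<longlonglongrightarrow> g w"
    using s(2) assms(2) by eventually_elim simp
  with s(1) show ?thesis
    unfolding strongly_measurable_def by blast
qed

lemma strongly_measurable_compose2:
  assumes f: "strongly_measurable M f" and g: "strongly_measurable M g"
    and h: "continuous_on UNIV (\<lambda>p. h (fst p) (snd p))"
  shows "strongly_measurable M (\<lambda>w. h (f w) (g w))"
proof -
  obtain s where s: "\<And>i. simple_function M (s i)" "AE w in M. (\<lambda>i. s i w) \<longlonglongrightarrow> f w"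
    using f unfolding strongly_measurable_def by auto
  obtain t where t: "\<And>i. simple_function M (t i)" "AE w in M. (\<lambda>i. t i w) \<longlonglongrightarrow> g w"
    using g unfolding strongly_measurable_def by auto
  have "AE w in M. (\<lambda>i. h (s i w) (t i w)) \<longlonglongrightarrow> h (f w) (g w)"
    using s(2) t(2)
  proof eventually_elim
    case (elim w)
    then have "(\<lambda>i. (s i w, t i w)) \<longlonglongrightarrow> (f w, g w)"
      by (intro tendsto_Pair)
    then show ?case
      using continuous_on_tendsto_compose[OF h, of "\<lambda>i. (s i w, t i w)" "(f w, g w)"] by simp
  qed
  moreover have "simple_function M (\<lambda>w. h (s i w) (t i w))" for i
    using s(1) t(1) by (rule simple_function_compose2)
  ultimately show ?thesis
    unfolding strongly_measurable_def by (intro exI[of _ "\<lambda>i w. h (s i w) (t i w)"] conjI allI)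
qed

lemma strongly_measurable_compose:
  assumes "strongly_measurable M f" "continuous_on UNIV h"
  shows "strongly_measurable M (\<lambda>w. h (f w))"
  by (rule strongly_measurable_compose2[OF assms(1) assms(1)])
     (intro continuous_on_compose2[OF assms(2)] continuous_intros, simp)

lemma strongly_measurable_add:
  "strongly_measurable M f \<Longrightarrow> strongly_measurable M g \<Longrightarrow> strongly_measurable M (\<lambda>w. f w + g w)"
  by (erule (1) strongly_measurable_compose2) (intro continuous_intros)

lemma strongly_measurable_diff:
  "strongly_measurable M f \<Longrightarrow> strongly_measurable M g \<Longrightarrow> strongly_measurable M (\<lambda>w. f w - g w)"
  by (erule (1) strongly_measurable_compose2) (intro continuous_intros)

lemma strongly_measurable_indicator_scaleR:
  assumes "A \<in> sets M" "strongly_measurable M f"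
  shows "strongly_measurable M (\<lambda>w. indicator A w *\<^sub>R f w)"
  by (rule strongly_measurable_compose2[OF _ assms(2)])
     (intro continuous_intros strongly_measurable_simple_function simple_function_indicator assms)+

text \<open>Up to a null set a strongly measurable function is an everywhere limit of simple functions,
  hence Borel measurable; this needs no countable base of the target space.\<close>

lemma strongly_measurable_borel_modification:
  fixes f :: "'a \<Rightarrow> 'b::real_normed_vector"
  assumes "strongly_measurable M f"
  obtains g where "g \<in> borel_measurable M" "AE w in M. f w = g w"
proof -
  obtain s where s: "\<And>i. simple_function M (s i)" "AE w in M. (\<lambda>i. s i w) \<longlonglongrightarrow> f w"
    using assms unfolding strongly_measurable_def by auto
  from s(2) obtain N where N: "\<And>w. w \<in> space M - N \<Longrightarrow> (\<lambda>i. s i w) \<longlonglongrightarrow> f w" "N \<in> null_sets M"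
    by (rule AE_E3) blast
  have [measurable]: "s i \<in> borel_measurable M" for i
    using s(1) by (rule borel_measurable_simple_function)
  have [measurable]: "N \<in> sets M" using N(2) by auto
  define g where "g = (\<lambda>w. if w \<in> N then 0 else f w)"
  have "g \<in> borel_measurable M"
  proof (rule borel_measurable_LIMSEQ_metric)
    show "(\<lambda>w. if w \<in> N then 0 else s i w) \<in> borel_measurable M" for i
      by measurable
    show "(\<lambda>i. if w \<in> N then 0 else s i w) \<longlonglongrightarrow> g w" if "w \<in> space M" for w
      using N(1)[of w] that by (auto simp: g_def)
  qed
  moreover have "AE w in M. f w = g w"
    using AE_not_in[OF N(2)] by eventually_elim (simp add: g_def)
  ultimately show ?thesis by (rule that)
qed

lemma strongly_measurable_norm_modification:
  assumes "strongly_measurable M f"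
  obtains u :: "'a \<Rightarrow> ennreal"
  where "u \<in> borel_measurable M" "AE w in M. ennreal (norm (f w)) = u w"
proof -
  obtain g where g: "g \<in> borel_measurable M" "AE w in M. f w = g w"
    using assms by (rule strongly_measurable_borel_modification)
  show ?thesis
  proof (rule that)
    show "(\<lambda>w. ennreal (norm (g w))) \<in> borel_measurable M"
      using g(1) by measurable
    show "AE w in M. ennreal (norm (f w)) = ennreal (norm (g w))"
      using g(2) by eventually_elim simp
  qed
qed

section \<open>The \<open>L\<^sup>1\<close> seminorm\<close>

text \<open>The \<open>L\<^sup>1\<close> seminorm of an arbitrary function, with infinite values allowed. For functions that
  are not measurable \<^const>\<open>nn_integral\<close> is only a lower integral, so additivity requires strong
  measurability.\<close>

definition l1_norm :: "'a measure \<Rightarrow> ('a \<Rightarrow> 'b::real_normed_vector) \<Rightarrow> ennreal" where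
  "l1_norm M f = (\<integral>\<^sup>+w. ennreal (norm (f w)) \<partial>M)"

lemma l1_norm_mono_AE:
  "AE w in M. norm (f w) \<le> norm (g w) \<Longrightarrow> l1_norm M f \<le> l1_norm M g"
  unfolding l1_norm_def by (intro nn_integral_mono_AE) (auto elim: eventually_mono)

lemma l1_norm_cong_AE:
  "AE w in M. f w = g w \<Longrightarrow> l1_norm M f = l1_norm M g"
  unfolding l1_norm_def by (intro nn_integral_cong_AE) (auto elim: eventually_mono)

lemma l1_norm_zero [simp]: "l1_norm M (\<lambda>_. 0) = 0"
  unfolding l1_norm_def by simp

lemma l1_norm_minus_commute: "l1_norm M (\<lambda>w. f w - g w) = l1_norm M (\<lambda>w. g w - f w)"
  unfolding l1_norm_def by (simp add: norm_minus_commute)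

lemma nn_integral_norm_add:
  assumes "strongly_measurable M f" "strongly_measurable M g"
  shows "(\<integral>\<^sup>+w. ennreal (norm (f w)) + ennreal (norm (g w)) \<partial>M) = l1_norm M f + l1_norm M g"
proof -
  obtain u where u: "u \<in> borel_measurable M" "AE w in M. ennreal (norm (f w)) = u w"
    using assms(1) by (rule strongly_measurable_norm_modification)
  obtain v where v: "v \<in> borel_measurable M" "AE w in M. ennreal (norm (g w)) = v w"
    using assms(2) by (rule strongly_measurable_norm_modification)
  have "(\<integral>\<^sup>+w. ennreal (norm (f w)) + ennreal (norm (g w)) \<partial>M) = (\<integral>\<^sup>+w. u w + v w \<partial>M)"
    by (rule nn_integral_cong_AE, use u(2) v(2) in eventually_elim) simp
  also have "\<dots> = (\<integral>\<^sup>+w. u w \<partial>M) + (\<integral>\<^sup>+w. v w \<partial>M)"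
    using u(1) v(1) by (rule nn_integral_add)
  also have "\<dots> = l1_norm M f + l1_norm M g"
    unfolding l1_norm_def using nn_integral_cong_AE[OF u(2)] nn_integral_cong_AE[OF v(2)] by simp
  finally show ?thesis .
qed

lemma nn_integral_norm_suminf:
  assumes "\<And>n::nat. strongly_measurable M (f n)"
  shows "(\<integral>\<^sup>+w. (\<Sum>n. ennreal (norm (f n w))) \<partial>M) = (\<Sum>n. l1_norm M (f n))"
    and "(\<Sum>n. l1_norm M (f n)) < \<infinity> \<Longrightarrow> AE w in M. summable (\<lambda>n. norm (f n w))"
proof -
  have "\<exists>u. u \<in> borel_measurable M \<and> (AE w in M. ennreal (norm (f n w)) = u w)" for n
    by (rule strongly_measurable_norm_modification[OF assms[of n]]) blast
  then obtain u where u: "\<And>n. u n \<in> borel_measurable M"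
    "\<And>n. AE w in M. ennreal (norm (f n w)) = u n w" by metis
  have AE: "AE w in M. \<forall>n. ennreal (norm (f n w)) = u n w"
    using u(2) by (simp add: AE_all_countable)
  have eq: "l1_norm M (f n) = (\<integral>\<^sup>+w. u n w \<partial>M)" for n
    unfolding l1_norm_def by (rule nn_integral_cong_AE[OF u(2)])
  have "(\<integral>\<^sup>+w. (\<Sum>n. ennreal (norm (f n w))) \<partial>M) = (\<integral>\<^sup>+w. (\<Sum>n. u n w) \<partial>M)"
    by (rule nn_integral_cong_AE, use AE in eventually_elim) simp
  also have sums: "\<dots> = (\<Sum>n. l1_norm M (f n))"
    using u(1) by (simp add: nn_integral_suminf eq)
  finally show "(\<integral>\<^sup>+w. (\<Sum>n. ennreal (norm (f n w))) \<partial>M) = (\<Sum>n. l1_norm M (f n))" .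
  assume "(\<Sum>n. l1_norm M (f n)) < \<infinity>"
  then have "AE w in M. (\<Sum>n. u n w) \<noteq> \<infinity>"
    using u(1) sums by (intro nn_integral_PInf_AE) auto
  then show "AE w in M. summable (\<lambda>n. norm (f n w))"
    using AE
  proof eventually_elim
    case (elim w)
    then have "(\<Sum>n. ennreal (norm (f n w))) \<noteq> top" by simp
    then show ?case by (rule summable_suminf_not_top[rotated]) simp
  qed
qed

lemma l1_norm_add_le:
  assumes "strongly_measurable M f" "strongly_measurable M g"
  shows "l1_norm M (\<lambda>w. f w + g w) \<le> l1_norm M f + l1_norm M g"
proof -
  have "l1_norm M (\<lambda>w. f w + g w) \<le> (\<integral>\<^sup>+w. ennreal (norm (f w)) + ennreal (norm (g w)) \<partial>M)"
    unfolding l1_norm_def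
    by (intro nn_integral_mono) (simp add: norm_triangle_ineq flip: ennreal_plus)
  then show ?thesis using nn_integral_norm_add[OF assms] by simp
qed

lemma l1_norm_diff_triangle:
  assumes "strongly_measurable M f" "strongly_measurable M g" "strongly_measurable M h"
  shows "l1_norm M (\<lambda>w. f w - h w) \<le> l1_norm M (\<lambda>w. f w - g w) + l1_norm M (\<lambda>w. g w - h w)"
  using l1_norm_add_le[of M "\<lambda>w. f w - g w" "\<lambda>w. g w - h w"] assms
  by (simp add: strongly_measurable_diff)

lemma l1_norm_triangle:
  assumes "strongly_measurable M f" "strongly_measurable M g"
  shows "l1_norm M f \<le> l1_norm M (\<lambda>w. f w - g w) + l1_norm M g"
  using l1_norm_add_le[of M "\<lambda>w. f w - g w" g] assms
  by (simp add: strongly_measurable_diff)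

lemma l1_norm_eq_0_AE:
  assumes "strongly_measurable M f" "l1_norm M f = 0"
  shows "AE w in M. f w = 0"
proof -
  obtain u where u: "u \<in> borel_measurable M" "AE w in M. ennreal (norm (f w)) = u w"
    using assms(1) by (rule strongly_measurable_norm_modification)
  have "(\<integral>\<^sup>+w. u w \<partial>M) = 0"
    using assms(2) nn_integral_cong_AE[OF u(2)] unfolding l1_norm_def by simp
  then have "AE w in M. u w = 0"
    using u(1) by (simp add: nn_integral_0_iff_AE)
  then show ?thesis using u(2) by eventually_elim (simp add: ennreal_eq_0_iff)
qed

lemma l1_norm_bounded_linear_le:
  assumes "strongly_measurable M f" "\<And>y. norm (L y) \<le> norm y * B" "0 \<le> B"
  shows "l1_norm M (\<lambda>w. L (f w)) \<le> ennreal B * l1_norm M f"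
proof -
  obtain u where u: "u \<in> borel_measurable M" "AE w in M. ennreal (norm (f w)) = u w"
    using assms(1) by (rule strongly_measurable_norm_modification)
  have "l1_norm M (\<lambda>w. L (f w)) \<le> (\<integral>\<^sup>+w. ennreal B * u w \<partial>M)"
    unfolding l1_norm_def
  proof (rule nn_integral_mono_AE, use u(2) in eventually_elim)
    case (elim w)
    have "ennreal (norm (L (f w))) \<le> ennreal (B * norm (f w))"
      using assms(2)[of "f w"] by (intro ennreal_leI) (simp add: mult.commute)
    then show ?case using elim assms(3) by (simp add: ennreal_mult)
  qed
  also have "\<dots> = ennreal B * l1_norm M f"
    unfolding l1_norm_def using u by (simp add: nn_integral_cmult nn_integral_cong_AE[OF u(2)])
  finally show ?thesis .
qed

section \<open>The Bochner integral\<close>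

text \<open>Simple functions with support of finite measure, and their vector-valued integral, as opposed to
  the Lebesgue integral \<^const>\<open>simple_integral\<close> with values in \<^typ>\<open>ennreal\<close>.\<close>

abbreviation "simple_integrable \<equiv> Bochner_Integration.simple_bochner_integrable"
abbreviation "simple_vec_integral \<equiv> Bochner_Integration.simple_bochner_integral"

lemma simple_integrable_imp_simple_function:
  "simple_integrable M s \<Longrightarrow> simple_function M s"
  by (auto elim: simple_bochner_integrable.cases)

lemma simple_integrable_imp_strongly_measurable:
  "simple_integrable M s \<Longrightarrow> strongly_measurable M s"
  by (intro strongly_measurable_simple_function simple_integrable_imp_simple_function)

lemma norm_simple_vec_integral_le:
  assumes s: "simple_integrable M s"
  shows "ennreal (norm (simple_vec_integral M s)) \<le> l1_norm M s"
proof -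
  have "ennreal (norm (simple_vec_integral M s)) \<le> ennreal (simple_vec_integral M (\<lambda>w. norm (s w)))"
    using simple_bochner_integral_norm_bound[OF s] by (rule ennreal_leI)
  also have "\<dots> = l1_norm M s"
    unfolding l1_norm_def using simple_bochner_integrable_compose2[of "\<lambda>x y. norm x" M s s] s
    by (intro simple_bochner_integral_eq_nn_integral) auto
  finally show ?thesis .
qed

lemma bochner_has_integralE:
  assumes "bochner_has_integral M f x"
  obtains s where "strongly_measurable M f" "\<And>i. simple_integrable M (s i)"
    "(\<lambda>i. l1_norm M (\<lambda>w. f w - s i w)) \<longlonglongrightarrow> 0" "(\<lambda>i. simple_vec_integral M (s i)) \<longlonglongrightarrow> x"
  using assms unfolding bochner_has_integral_def l1_norm_def by blast

lemma bochner_has_integralI: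
  assumes "strongly_measurable M f" "\<And>i. simple_integrable M (s i)"
    "(\<lambda>i. l1_norm M (\<lambda>w. f w - s i w)) \<longlonglongrightarrow> 0" "(\<lambda>i. simple_vec_integral M (s i)) \<longlonglongrightarrow> x"
  shows "bochner_has_integral M f x"
  using assms unfolding bochner_has_integral_def l1_norm_def by blast

lemma bochner_has_integral_norm_le:
  assumes "bochner_has_integral M f x"
  shows "ennreal (norm x) \<le> l1_norm M f"
proof -
  from assms obtain s where s: "strongly_measurable M f" "\<And>i. simple_integrable M (s i)"
    "(\<lambda>i. l1_norm M (\<lambda>w. f w - s i w)) \<longlonglongrightarrow> 0" "(\<lambda>i. simple_vec_integral M (s i)) \<longlonglongrightarrow> x"
    by (rule bochner_has_integralE) blast
  have sm: "strongly_measurable M (s i)" for i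
    using s(2) by (rule simple_integrable_imp_strongly_measurable)
  have lim: "(\<lambda>i. ennreal (norm (simple_vec_integral M (s i)))) \<longlonglongrightarrow> ennreal (norm x)"
    using s(4) by (intro tendsto_ennrealI tendsto_norm)
  have lim': "(\<lambda>i. l1_norm M (\<lambda>w. f w - s i w) + l1_norm M f) \<longlonglongrightarrow> 0 + l1_norm M f"
    by (intro tendsto_add s(3) tendsto_const)
  have "ennreal (norm (simple_vec_integral M (s i))) \<le> l1_norm M (\<lambda>w. f w - s i w) + l1_norm M f" for i
    using norm_simple_vec_integral_le[OF s(2)[of i]] l1_norm_triangle[OF sm[of i] s(1)]
    by (simp add: l1_norm_minus_commute)
  then show ?thesis
    using LIMSEQ_le[OF lim lim'] by simp
qed

lemma bochner_has_integral_simple: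
  assumes "simple_integrable M s"
  shows "bochner_has_integral M s (simple_vec_integral M s)"
  by (rule bochner_has_integralI[where s = "\<lambda>_. s"])
     (simp_all add: assms simple_integrable_imp_strongly_measurable)

lemma bochner_has_integral_cong_AE:
  assumes "bochner_has_integral M f x" "AE w in M. f w = g w"
  shows "bochner_has_integral M g x"
proof -
  from assms(1) obtain s where s: "strongly_measurable M f" "\<And>i. simple_integrable M (s i)"
    "(\<lambda>i. l1_norm M (\<lambda>w. f w - s i w)) \<longlonglongrightarrow> 0" "(\<lambda>i. simple_vec_integral M (s i)) \<longlonglongrightarrow> x"
    by (rule bochner_has_integralE) blast
  have "l1_norm M (\<lambda>w. f w - s i w) = l1_norm M (\<lambda>w. g w - s i w)" for i
    by (rule l1_norm_cong_AE, use assms(2) in eventually_elim) simp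
  then show ?thesis
    using s strongly_measurable_cong_AE[OF s(1) assms(2)] by (intro bochner_has_integralI[of M g s]) auto
qed

lemma bochner_has_integral_add:
  assumes "bochner_has_integral M f x" "bochner_has_integral M g y"
  shows "bochner_has_integral M (\<lambda>w. f w + g w) (x + y)"
proof -
  from assms(1) obtain s where s: "strongly_measurable M f" "\<And>i. simple_integrable M (s i)"
    "(\<lambda>i. l1_norm M (\<lambda>w. f w - s i w)) \<longlonglongrightarrow> 0" "(\<lambda>i. simple_vec_integral M (s i)) \<longlonglongrightarrow> x"
    by (rule bochner_has_integralE) blast
  from assms(2) obtain t where t: "strongly_measurable M g" "\<And>i. simple_integrable M (t i)"
    "(\<lambda>i. l1_norm M (\<lambda>w. g w - t i w)) \<longlonglongrightarrow> 0" "(\<lambda>i. simple_vec_integral M (t i)) \<longlonglongrightarrow> y"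
    by (rule bochner_has_integralE) blast
  have sm: "strongly_measurable M (s i)" "strongly_measurable M (t i)" for i
    using s(2) t(2) by (auto intro: simple_integrable_imp_strongly_measurable)
  show ?thesis
  proof (rule bochner_has_integralI)
    show "strongly_measurable M (\<lambda>w. f w + g w)"
      using s(1) t(1) by (rule strongly_measurable_add)
    show "simple_integrable M (\<lambda>w. s i w + t i w)" for i
      using s(2) t(2) by (intro simple_bochner_integrable_compose2[where p = "(+)"]) auto
    show "(\<lambda>i. simple_vec_integral M (\<lambda>w. s i w + t i w)) \<longlonglongrightarrow> x + y"
      using s t by (simp add: simple_bochner_integral_add tendsto_add)
    have lim: "(\<lambda>i. l1_norm M (\<lambda>w. f w - s i w) + l1_norm M (\<lambda>w. g w - t i w)) \<longlonglongrightarrow> 0"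
      using tendsto_add[OF s(3) t(3)] by simp
    have "l1_norm M (\<lambda>w. (f w + g w) - (s i w + t i w))
        \<le> l1_norm M (\<lambda>w. f w - s i w) + l1_norm M (\<lambda>w. g w - t i w)" for i
      using l1_norm_add_le[of M "\<lambda>w. f w - s i w" "\<lambda>w. g w - t i w"] s(1) t(1) sm
      by (simp add: strongly_measurable_diff algebra_simps)
    then show "(\<lambda>i. l1_norm M (\<lambda>w. (f w + g w) - (s i w + t i w))) \<longlonglongrightarrow> 0"
      by (intro tendsto_sandwich[OF _ _ tendsto_const lim]) auto
  qed
qed

lemma bochner_has_integral_bounded_linear:
  assumes L: "bounded_linear L" and f: "bochner_has_integral M f x"
  shows "bochner_has_integral M (\<lambda>w. L (f w)) (L x)"
proof -
  interpret L: bounded_linear L by fact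
  from f obtain s where s: "strongly_measurable M f" "\<And>i. simple_integrable M (s i)"
    "(\<lambda>i. l1_norm M (\<lambda>w. f w - s i w)) \<longlonglongrightarrow> 0" "(\<lambda>i. simple_vec_integral M (s i)) \<longlonglongrightarrow> x"
    by (rule bochner_has_integralE) blast
  obtain B where B: "\<And>y. norm (L y) \<le> norm y * B" "0 \<le> B"
    using L.nonneg_bounded by auto
  show ?thesis
  proof (rule bochner_has_integralI)
    show "strongly_measurable M (\<lambda>w. L (f w))"
      using s(1) by (rule strongly_measurable_compose) (rule L.continuous_on, rule continuous_on_id)
    show "simple_integrable M (\<lambda>w. L (s i w))" for i
      using simple_bochner_integrable_compose2[of "\<lambda>x y. L x" M "s i" "s i"] s(2) L.zero by simp
    show "(\<lambda>i. simple_vec_integral M (\<lambda>w. L (s i w))) \<longlonglongrightarrow> L x"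
      using L.tendsto[OF s(4)] by (simp add: simple_bochner_integral_linear[OF L.linear_axioms s(2)])
    have lim: "(\<lambda>i. ennreal B * l1_norm M (\<lambda>w. f w - s i w)) \<longlonglongrightarrow> 0"
      using ennreal_tendsto_cmult[OF _ s(3), of "ennreal B"] by simp
    have "l1_norm M (\<lambda>w. L (f w) - L (s i w)) \<le> ennreal B * l1_norm M (\<lambda>w. f w - s i w)" for i
      using l1_norm_bounded_linear_le[of M "\<lambda>w. f w - s i w" L B] s(1,2) B
      by (simp add: L.diff strongly_measurable_diff simple_integrable_imp_strongly_measurable)
    then show "(\<lambda>i. l1_norm M (\<lambda>w. L (f w) - L (s i w))) \<longlonglongrightarrow> 0"
      by (intro tendsto_sandwich[OF _ _ tendsto_const lim]) auto
  qed
qed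

lemma bochner_has_integral_diff:
  assumes "bochner_has_integral M f x" "bochner_has_integral M g y"
  shows "bochner_has_integral M (\<lambda>w. f w - g w) (x - y)"
  using bochner_has_integral_add[OF assms(1) bochner_has_integral_bounded_linear[OF
      bounded_linear_minus[OF bounded_linear_ident] assms(2)]] by simp

lemma bochner_has_integral_unique:
  assumes "bochner_has_integral M f x" "bochner_has_integral M f y"
  shows "x = y"
  using bochner_has_integral_norm_le[OF bochner_has_integral_diff[OF assms]] by simp

lemma bochner_integral_eqI: "bochner_has_integral M f x \<Longrightarrow> bochner_integral M f = x"
  unfolding bochner_integral_def bochner_integrable_def
  by (auto intro: bochner_has_integral_unique the_equality)

lemma bochner_has_integral_bochner_integral:
  "bochner_integrable M f \<Longrightarrow> bochner_has_integral M f (bochner_integral M f)"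
  using bochner_integral_eqI unfolding bochner_integrable_def by metis

lemma bochner_integrable_imp_strongly_measurable:
  "bochner_integrable M f \<Longrightarrow> strongly_measurable M f"
  unfolding bochner_integrable_def bochner_has_integral_def by auto

lemma
  assumes "bochner_integrable M f" "bochner_integrable M g"
  shows bochner_integrable_add: "bochner_integrable M (\<lambda>w. f w + g w)"
    and bochner_integral_add:
      "bochner_integral M (\<lambda>w. f w + g w) = bochner_integral M f + bochner_integral M g"
    and bochner_integrable_diff: "bochner_integrable M (\<lambda>w. f w - g w)"
    and bochner_integral_diff:
      "bochner_integral M (\<lambda>w. f w - g w) = bochner_integral M f - bochner_integral M g"
proof -
  note add = bochner_has_integral_add[OF assms[THEN bochner_has_integral_bochner_integral]]
  note diff = bochner_has_integral_diff[OF assms[THEN bochner_has_integral_bochner_integral]]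
  show "bochner_integrable M (\<lambda>w. f w + g w)" "bochner_integrable M (\<lambda>w. f w - g w)"
    unfolding bochner_integrable_def using add diff by blast+
  show "bochner_integral M (\<lambda>w. f w + g w) = bochner_integral M f + bochner_integral M g"
    "bochner_integral M (\<lambda>w. f w - g w) = bochner_integral M f - bochner_integral M g"
    by (rule bochner_integral_eqI[OF add] bochner_integral_eqI[OF diff])+
qed

lemma
  assumes "bounded_linear L" "bochner_integrable M f"
  shows bochner_integrable_bounded_linear: "bochner_integrable M (\<lambda>w. L (f w))"
    and bochner_integral_bounded_linear:
      "bochner_integral M (\<lambda>w. L (f w)) = L (bochner_integral M f)"
proof -
  note L = bochner_has_integral_bounded_linear[OF assms(1) assms(2)[THEN bochner_has_integral_bochner_integral]]
  show "bochner_integrable M (\<lambda>w. L (f w))"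
    unfolding bochner_integrable_def using L by blast
  show "bochner_integral M (\<lambda>w. L (f w)) = L (bochner_integral M f)"
    by (rule bochner_integral_eqI[OF L])
qed

lemma bochner_integrable_cong_AE:
  "bochner_integrable M f \<Longrightarrow> AE w in M. f w = g w \<Longrightarrow> bochner_integrable M g"
  using bochner_has_integral_cong_AE unfolding bochner_integrable_def by blast

lemma bochner_integral_cong_AE:
  assumes "bochner_integrable M f" "AE w in M. f w = g w"
  shows "bochner_integral M f = bochner_integral M g"
  using bochner_has_integral_cong_AE[OF bochner_has_integral_bochner_integral[OF assms(1)] assms(2)]
  by (simp add: bochner_integral_eqI)

lemma norm_bochner_integral_le:
  "bochner_integrable M f \<Longrightarrow> ennreal (norm (bochner_integral M f)) \<le> l1_norm M f"
  by (intro bochner_has_integral_norm_le bochner_has_integral_bochner_integral)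

lemma bochner_integrable_simple: "simple_integrable M s \<Longrightarrow> bochner_integrable M s"
  unfolding bochner_integrable_def using bochner_has_integral_simple by blast

lemma bochner_integrable_zero: "bochner_integrable M (\<lambda>_. 0)"
  by (rule bochner_integrable_simple, rule simple_bochner_integrable.intros) simp_all

text \<open>In a complete space the integrals of an \<open>L\<^sup>1\<close> approximation by simple functions converge
  automatically.\<close>

lemma bochner_integrableI:
  fixes f :: "'a \<Rightarrow> 'b::banach"
  assumes f: "strongly_measurable M f" and s: "\<And>i. simple_integrable M (s i)"
    and lim: "(\<lambda>i. l1_norm M (\<lambda>w. f w - s i w)) \<longlonglongrightarrow> 0"
  shows "bochner_integrable M f"
proof -
  have "Cauchy (\<lambda>i. simple_vec_integral M (s i))"
  proof (rule metric_CauchyI)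
    fix e :: real assume e: "0 < e"
    have "eventually (\<lambda>i. l1_norm M (\<lambda>w. f w - s i w) < ennreal (e / 2)) sequentially"
      using order_tendstoD(2)[OF lim, of "ennreal (e / 2)"] e by simp
    then obtain n where n: "\<And>i. i \<ge> n \<Longrightarrow> l1_norm M (\<lambda>w. f w - s i w) < ennreal (e / 2)"
      unfolding eventually_sequentially by auto
    show "\<exists>n. \<forall>i\<ge>n. \<forall>j\<ge>n. dist (simple_vec_integral M (s i)) (simple_vec_integral M (s j)) < e"
    proof (intro exI allI impI)
      fix i j assume ij: "i \<ge> n" "j \<ge> n"
      have "ennreal (dist (simple_vec_integral M (s i)) (simple_vec_integral M (s j)))
          = ennreal (norm (simple_vec_integral M (\<lambda>w. s i w - s j w)))"
        by (simp add: dist_norm simple_bochner_integral_diff s)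
      also have "\<dots> \<le> l1_norm M (\<lambda>w. s i w - s j w)"
        by (intro norm_simple_vec_integral_le simple_bochner_integrable_compose2[where p = "(-)"] s) simp
      also have "\<dots> \<le> l1_norm M (\<lambda>w. s i w - f w) + l1_norm M (\<lambda>w. f w - s j w)"
        by (intro l1_norm_diff_triangle simple_integrable_imp_strongly_measurable s f)
      also have "\<dots> < ennreal (e / 2) + ennreal (e / 2)"
        using n[OF ij(1)] n[OF ij(2)]
        by (subst l1_norm_minus_commute) (rule add_strict_mono)
      also have "\<dots> = ennreal e"
        using e by (simp flip: ennreal_plus)
      finally show "dist (simple_vec_integral M (s i)) (simple_vec_integral M (s j)) < e"
        using e by (simp add: ennreal_less_iff)
    qed
  qed
  then obtain x where "(\<lambda>i. simple_vec_integral M (s i)) \<longlonglongrightarrow> x"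
    using Cauchy_convergent convergent_def by blast
  then show ?thesis
    unfolding bochner_integrable_def using bochner_has_integralI[OF f s lim] by blast
qed

lemma bochner_integrable_simple_approx:
  assumes "bochner_integrable M f" "0 < e"
  obtains s where "simple_integrable M s" "l1_norm M (\<lambda>w. f w - s w) < ennreal e"
proof -
  obtain s where s: "\<And>i. simple_integrable M (s i)" "(\<lambda>i. l1_norm M (\<lambda>w. f w - s i w)) \<longlonglongrightarrow> 0"
    using bochner_has_integralE[OF bochner_has_integral_bochner_integral[OF assms(1)]] by blast
  have "eventually (\<lambda>i. l1_norm M (\<lambda>w. f w - s i w) < ennreal e) sequentially"
    using order_tendstoD(2)[OF s(2), of "ennreal e"] assms(2) by simp
  then show ?thesis
    using s(1) that unfolding eventually_sequentially by blast
qed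

lemma bochner_integrable_indicator_scaleR:
  fixes f :: "'a \<Rightarrow> 'b::banach"
  assumes f: "bochner_integrable M f" and A: "A \<in> sets M"
  shows "bochner_integrable M (\<lambda>w. indicator A w *\<^sub>R f w)"
proof -
  obtain s where s: "\<And>i. simple_integrable M (s i)" "(\<lambda>i. l1_norm M (\<lambda>w. f w - s i w)) \<longlonglongrightarrow> 0"
    using bochner_has_integralE[OF bochner_has_integral_bochner_integral[OF f]] by blast
  show ?thesis
  proof (rule bochner_integrableI)
    show "strongly_measurable M (\<lambda>w. indicator A w *\<^sub>R f w)"
      using A bochner_integrable_imp_strongly_measurable[OF f]
      by (rule strongly_measurable_indicator_scaleR)
    show "simple_integrable M (\<lambda>w. indicator A w *\<^sub>R s i w)" for i
    proof (rule simple_bochner_integrable.intros)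
      show "simple_function M (\<lambda>w. indicator A w *\<^sub>R s i w)"
        using A s(1)[of i, THEN simple_integrable_imp_simple_function]
        by (intro simple_function_compose2[where h = "(*\<^sub>R)"] simple_function_indicator)
      have [measurable]: "s i \<in> M \<rightarrow>\<^sub>M count_space UNIV"
        using s(1)[of i, THEN simple_integrable_imp_simple_function]
        by (rule measurable_simple_function)
      have "emeasure M {w \<in> space M. indicator A w *\<^sub>R s i w \<noteq> 0} \<le> emeasure M {w \<in> space M. s i w \<noteq> 0}"
        by (intro emeasure_mono) auto
      moreover have "emeasure M {w \<in> space M. s i w \<noteq> 0} \<noteq> \<infinity>"
        using s(1)[of i] by (auto elim: simple_bochner_integrable.cases)
      ultimately show "emeasure M {w \<in> space M. indicator A w *\<^sub>R s i w \<noteq> 0} \<noteq> \<infinity>"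
        by (auto simp: top_unique)
    qed
    have "l1_norm M (\<lambda>w. indicator A w *\<^sub>R f w - indicator A w *\<^sub>R s i w)
        \<le> l1_norm M (\<lambda>w. f w - s i w)" for i
      by (intro l1_norm_mono_AE) (auto simp: indicator_def)
    then show "(\<lambda>i. l1_norm M (\<lambda>w. indicator A w *\<^sub>R f w - indicator A w *\<^sub>R s i w)) \<longlonglongrightarrow> 0"
      by (intro tendsto_sandwich[OF _ _ tendsto_const s(2)]) auto
  qed
qed

text \<open>Completeness of \<open>L\<^sup>1\<close>, in the form for fast Cauchy sequences: the increments are almost
  surely absolutely summable, so the limit is also an almost sure one.\<close>

lemma l1_complete:
  fixes g :: "nat \<Rightarrow> 'a \<Rightarrow> 'b::banach"
  assumes g: "\<And>n. bochner_integrable M (g n)"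
    and c: "summable c" "\<And>n. 0 \<le> c n"
    and le: "\<And>n. l1_norm M (\<lambda>w. g (Suc n) w - g n w) \<le> ennreal (c n)"
  obtains h where "bochner_integrable M h" "AE w in M. (\<lambda>n. g n w) \<longlonglongrightarrow> h w"
    "(\<lambda>n. l1_norm M (\<lambda>w. h w - g n w)) \<longlonglongrightarrow> 0"
proof -
  define d where "d n w = g (Suc n) w - g n w" for n w
  define h where "h w = g 0 w + (\<Sum>n. d n w)" for w
  have smg: "strongly_measurable M (g n)" for n
    using g by (rule bochner_integrable_imp_strongly_measurable)
  have smd: "strongly_measurable M (d n)" for n
    unfolding d_def[abs_def] by (intro strongly_measurable_diff smg)
  have d_le: "l1_norm M (d n) \<le> ennreal (c n)" for n
    using le unfolding d_def[abs_def] .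
  have tail_le: "(\<Sum>k. l1_norm M (d (k + n))) \<le> ennreal (\<Sum>k. c (k + n))" for n
  proof -
    have "summable (\<lambda>k. c (k + n))" using c(1) by (simp add: summable_iff_shift)
    then have "(\<Sum>k. ennreal (c (k + n))) = ennreal (\<Sum>k. c (k + n))"
      by (intro suminf_ennreal2 c(2))
    moreover have "(\<Sum>k. l1_norm M (d (k + n))) \<le> (\<Sum>k. ennreal (c (k + n)))"
      by (intro suminf_le d_le) auto
    ultimately show ?thesis by simp
  qed
  have summable: "AE w in M. summable (\<lambda>n. norm (d n w))"
    using tail_le[of 0] by (intro nn_integral_norm_suminf(2) smd) (simp add: le_less_trans)
  have g_eq: "g n w = g 0 w + (\<Sum>k<n. d k w)" for n w
    unfolding d_def sum_lessThan_telescope[of "\<lambda>k. g k w" n] by simp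
  have lim: "AE w in M. (\<lambda>n. g n w) \<longlonglongrightarrow> h w"
    using summable
  proof eventually_elim
    case (elim w)
    have "(\<lambda>n. g 0 w + (\<Sum>k<n. d k w)) \<longlonglongrightarrow> h w"
      unfolding h_def
      by (rule tendsto_add[OF tendsto_const summable_LIMSEQ[OF summable_norm_cancel[OF elim]]])
    then show ?case by (simp flip: g_eq)
  qed
  have h_le: "l1_norm M (\<lambda>w. h w - g n w) \<le> ennreal (\<Sum>k. c (k + n))" for n
  proof -
    have "l1_norm M (\<lambda>w. h w - g n w) \<le> (\<integral>\<^sup>+w. (\<Sum>k. ennreal (norm (d (k + n) w))) \<partial>M)"
      unfolding l1_norm_def
    proof (rule nn_integral_mono_AE, use summable in eventually_elim)
      case (elim w)
      then have sn: "summable (\<lambda>k. norm (d (k + n) w))"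
        by (subst summable_iff_shift)
      have "h w - g n w = (\<Sum>k. d (k + n) w)"
        unfolding h_def g_eq[of n w]
        using suminf_minus_initial_segment[OF summable_norm_cancel[OF elim], of n] by simp
      then have "norm (h w - g n w) \<le> (\<Sum>k. norm (d (k + n) w))"
        using summable_norm[OF sn] by simp
      then have "ennreal (norm (h w - g n w)) \<le> ennreal (\<Sum>k. norm (d (k + n) w))"
        by (rule ennreal_leI)
      also have "\<dots> = (\<Sum>k. ennreal (norm (d (k + n) w)))"
        using sn by (intro suminf_ennreal2[symmetric]) auto
      finally show ?case .
    qed
    also have "\<dots> = (\<Sum>k. l1_norm M (d (k + n)))"
      by (intro nn_integral_norm_suminf(1) smd)
    finally show ?thesis using tail_le[of n] by simp
  qed
  have "(\<lambda>n. suminf c - (\<Sum>k<n. c k)) \<longlonglongrightarrow> suminf c - suminf c"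
    by (intro tendsto_diff tendsto_const summable_LIMSEQ c(1))
  then have "(\<lambda>n. \<Sum>k. c (k + n)) \<longlonglongrightarrow> 0"
    by (simp add: suminf_minus_initial_segment[OF c(1)])
  then have c_lim: "(\<lambda>n. ennreal (\<Sum>k. c (k + n))) \<longlonglongrightarrow> 0"
    using tendsto_ennrealI by fastforce
  have hg: "(\<lambda>n. l1_norm M (\<lambda>w. h w - g n w)) \<longlonglongrightarrow> 0"
    using h_le by (intro tendsto_sandwich[OF _ _ tendsto_const c_lim]) auto
  \<comment> \<open>simple functions close enough to the \<open>g n\<close> converge to \<open>h\<close> as well\<close>
  have "\<exists>t. simple_integrable M t \<and> l1_norm M (\<lambda>w. g n w - t w) \<le> ennreal ((1 / 2) ^ n)" for n
    by (rule bochner_integrable_simple_approx[OF g[of n], of "(1 / 2) ^ n"]) (auto intro: less_imp_le)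
  then obtain t where t: "\<And>n. simple_integrable M (t n)"
    "\<And>n. l1_norm M (\<lambda>w. g n w - t n w) \<le> ennreal ((1 / 2) ^ n)" by metis
  have smt: "strongly_measurable M (t n)" for n
    using t(1) by (rule simple_integrable_imp_strongly_measurable)
  have "(\<Sum>n. l1_norm M (\<lambda>w. g n w - t n w)) \<le> (\<Sum>n. ennreal ((1 / 2) ^ n))"
    by (intro suminf_le t(2)) auto
  also have "\<dots> = ennreal (\<Sum>n. (1 / 2) ^ n)"
    by (intro suminf_ennreal2) (auto intro: summable_geometric)
  finally have "(\<Sum>n. l1_norm M (\<lambda>w. g n w - t n w)) < \<infinity>"
    by (simp add: le_less_trans)
  then have gt: "AE w in M. summable (\<lambda>n. norm (g n w - t n w))"
    by (intro nn_integral_norm_suminf(2) strongly_measurable_diff smg smt)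
  have "AE w in M. (\<lambda>n. t n w) \<longlonglongrightarrow> h w"
    using gt lim
  proof eventually_elim
    case (elim w)
    then have "(\<lambda>n. g n w - t n w) \<longlonglongrightarrow> 0"
      using summable_LIMSEQ_zero tendsto_norm_zero_iff by blast
    from tendsto_diff[OF elim(2) this] show ?case by simp
  qed
  then have smh: "strongly_measurable M h"
    unfolding strongly_measurable_def using simple_integrable_imp_simple_function[OF t(1)] by blast
  have "(\<lambda>n. l1_norm M (\<lambda>w. h w - t n w)) \<longlonglongrightarrow> 0"
  proof (rule tendsto_sandwich[OF _ _ tendsto_const])
    have "(\<lambda>n. ennreal ((1 / 2) ^ n)) \<longlonglongrightarrow> ennreal 0"
      by (intro tendsto_ennrealI LIMSEQ_power_zero) simp
    then show "(\<lambda>n. l1_norm M (\<lambda>w. h w - g n w) + ennreal ((1 / 2) ^ n)) \<longlonglongrightarrow> 0"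
      using tendsto_add[OF hg] by fastforce
    show "eventually (\<lambda>n. l1_norm M (\<lambda>w. h w - t n w)
        \<le> l1_norm M (\<lambda>w. h w - g n w) + ennreal ((1 / 2) ^ n)) sequentially"
      using l1_norm_diff_triangle[OF smh smg smt] t(2)
      by (intro always_eventually allI) (meson add_left_mono order_trans)
  qed simp
  then have "bochner_integrable M h"
    by (rule bochner_integrableI[OF smh t(1)])
  then show ?thesis using lim hg by (rule that)
qed

lemma bochner_integral_indicator_tendsto:
  fixes h :: "'a \<Rightarrow> 'b::banach"
  assumes h: "bochner_integrable M h" "\<And>n. bochner_integrable M (g n)"
    and lim: "(\<lambda>n. l1_norm M (\<lambda>w. h w - g n w)) \<longlonglongrightarrow> 0" and A: "A \<in> sets M"
  shows "(\<lambda>n. bochner_integral M (\<lambda>w. indicator A w *\<^sub>R g n w))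
    \<longlonglongrightarrow> bochner_integral M (\<lambda>w. indicator A w *\<^sub>R h w)"
proof -
  let ?I = "\<lambda>f. bochner_integral M (\<lambda>w. indicator A w *\<^sub>R f w)"
  have le: "ennreal (norm (?I (g n) - ?I h)) \<le> l1_norm M (\<lambda>w. h w - g n w)" for n
  proof -
    note int = bochner_integrable_indicator_scaleR[OF _ A]
    have "ennreal (norm (?I (g n) - ?I h)) = ennreal (norm (bochner_integral M
        (\<lambda>w. indicator A w *\<^sub>R h w - indicator A w *\<^sub>R g n w)))"
      by (simp add: bochner_integral_diff int h norm_minus_commute)
    also have "\<dots> \<le> l1_norm M (\<lambda>w. indicator A w *\<^sub>R h w - indicator A w *\<^sub>R g n w)"
      by (intro norm_bochner_integral_le bochner_integrable_diff int h)
    also have "\<dots> \<le> l1_norm M (\<lambda>w. h w - g n w)"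
      by (intro l1_norm_mono_AE) (auto simp: indicator_def)
    finally show ?thesis .
  qed
  have "(\<lambda>n. ennreal (norm (?I (g n) - ?I h))) \<longlonglongrightarrow> 0"
    using le by (intro tendsto_sandwich[OF _ _ tendsto_const lim]) auto
  then have "(\<lambda>n. norm (?I (g n) - ?I h)) \<longlonglongrightarrow> 0"
    by (subst (asm) ennreal_tendsto_0_iff) auto
  then show ?thesis
    using LIM_zero_cancel tendsto_norm_zero_iff by blast
qed

lemma bochner_has_integral_real:
  fixes u :: "'a \<Rightarrow> real"
  assumes "integrable M u"
  shows "bochner_has_integral M u (integral\<^sup>L M u)"
  using assms bochner_has_integral_iff_has_bochner_integral[of u M]
  by (simp add: has_bochner_integral_integrable borel_measurable_integrable)

section \<open>Restriction to a sub-\<open>\<sigma>\<close>-algebra\<close>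

lemma simple_function_restr_to_subalg:
  assumes "subalgebra M F" "simple_function (restr_to_subalg M F) s"
  shows "simple_function M s"
  using assms unfolding simple_function_def
  by (auto simp: space_restr_to_subalg sets_restr_to_subalg subalgebra_def)

lemma l1_norm_restr_to_subalg:
  assumes sub: "subalgebra M F" and f: "strongly_measurable (restr_to_subalg M F) f"
  shows "l1_norm (restr_to_subalg M F) f = l1_norm M f"
proof -
  obtain u where u: "u \<in> borel_measurable (restr_to_subalg M F)"
    "AE w in restr_to_subalg M F. ennreal (norm (f w)) = u w"
    using f by (rule strongly_measurable_norm_modification)
  have uF: "u \<in> borel_measurable F"
    using u(1) measurable_in_subalg'[OF sub] by blast
  have "l1_norm (restr_to_subalg M F) f = (\<integral>\<^sup>+w. u w \<partial>restr_to_subalg M F)"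
    unfolding l1_norm_def using u(2) by (rule nn_integral_cong_AE)
  also have "\<dots> = (\<integral>\<^sup>+w. u w \<partial>M)"
    by (rule nn_integral_subalgebra2[OF sub uF])
  also have "\<dots> = l1_norm M f"
    unfolding l1_norm_def using AE_restr_to_subalg[OF sub u(2)]
    by (rule nn_integral_cong_AE[symmetric])
  finally show ?thesis .
qed

lemma simple_integrable_restr_to_subalg:
  fixes s :: "'a \<Rightarrow> 'b::real_normed_vector"
  assumes sub: "subalgebra M F" and s: "simple_integrable (restr_to_subalg M F) s"
  shows "simple_integrable M s" "simple_vec_integral (restr_to_subalg M F) s = simple_vec_integral M s"
proof -
  note sf = simple_integrable_imp_simple_function[OF s]
  have set: "{w \<in> space M. P (s w)} \<in> sets F" for P
  proof -
    have "{w \<in> space M. P (s w)} = s -` Collect P \<inter> space (restr_to_subalg M F)"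
      by (auto simp: space_restr_to_subalg)
    then show ?thesis
      using simple_functionD(2)[OF sf] sets_restr_to_subalg[OF sub] by metis
  qed
  have em: "emeasure (restr_to_subalg M F) {w \<in> space M. P (s w)} = emeasure M {w \<in> space M. P (s w)}" for P
    by (rule emeasure_restr_to_subalg[OF sub set])
  show "simple_integrable M s"
  proof (rule simple_bochner_integrable.intros)
    show "simple_function M s"
      by (rule simple_function_restr_to_subalg[OF sub sf])
    have "emeasure (restr_to_subalg M F) {w \<in> space M. s w \<noteq> 0} \<noteq> \<infinity>"
      using s by (auto elim!: simple_bochner_integrable.cases simp: space_restr_to_subalg)
    then show "emeasure M {w \<in> space M. s w \<noteq> 0} \<noteq> \<infinity>"
      unfolding em[of "\<lambda>v. v \<noteq> 0"] .
  qed
  show "simple_vec_integral (restr_to_subalg M F) s = simple_vec_integral M s"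
    unfolding simple_bochner_integral_def space_restr_to_subalg measure_def em[of "\<lambda>v. v = y" for y]
    by (rule refl)
qed

lemma bochner_integrable_restr_to_subalg:
  assumes sub: "subalgebra M F" and g: "bochner_integrable (restr_to_subalg M F) g"
  shows "bochner_integrable M g"
proof -
  let ?R = "restr_to_subalg M F"
  obtain s where s: "strongly_measurable ?R g" "\<And>i. simple_integrable ?R (s i)"
    "(\<lambda>i. l1_norm ?R (\<lambda>w. g w - s i w)) \<longlonglongrightarrow> 0"
    "(\<lambda>i. simple_vec_integral ?R (s i)) \<longlonglongrightarrow> bochner_integral ?R g"
    using bochner_has_integral_bochner_integral[OF g] by (rule bochner_has_integralE) blast
  obtain t where t: "\<And>i. simple_function ?R (t i)" "AE w in ?R. (\<lambda>i. t i w) \<longlonglongrightarrow> g w"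
    using s(1) unfolding strongly_measurable_def by auto
  have smM: "strongly_measurable M g"
    unfolding strongly_measurable_def
    by (intro exI[of _ t] conjI allI simple_function_restr_to_subalg[OF sub t(1)]
        AE_restr_to_subalg[OF sub t(2)])
  have eq: "l1_norm ?R (\<lambda>w. g w - s i w) = l1_norm M (\<lambda>w. g w - s i w)" for i
    by (intro l1_norm_restr_to_subalg[OF sub] strongly_measurable_diff s(1)
        simple_integrable_imp_strongly_measurable s(2))
  have "bochner_has_integral M g (bochner_integral ?R g)"
    by (rule bochner_has_integralI[OF smM simple_integrable_restr_to_subalg(1)[OF sub s(2)]])
      (use s(3,4) in \<open>simp_all add: eq simple_integrable_restr_to_subalg(2)[OF sub s(2)]\<close>)
  then show ?thesis unfolding bochner_integrable_def by blast
qed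

section \<open>Versions of the conditional expectation\<close>

text \<open>The property of \<^const>\<open>is_cond_exp\<close> with Borel measurability of the version dropped, which makes
  it stable under sums and limits in spaces without a countable base, and with Bochner
  integrability of \<open>f\<close> added.\<close>

definition cond_exp_version ::
  "'a measure \<Rightarrow> 'a measure \<Rightarrow> ('a \<Rightarrow> 'b::banach) \<Rightarrow> ('a \<Rightarrow> 'b) \<Rightarrow> bool" where
  "cond_exp_version M F f g \<longleftrightarrow>
     bochner_integrable M f \<and> bochner_integrable (restr_to_subalg M F) g \<and>
     (\<forall>A\<in>sets F. bochner_integral M (\<lambda>w. indicator A w *\<^sub>R g w)
               = bochner_integral M (\<lambda>w. indicator A w *\<^sub>R f w))"

lemma is_cond_exp_iff_cond_exp_version:
  "bochner_integrable M f \<Longrightarrow>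
    is_cond_exp M F f g \<longleftrightarrow> g \<in> borel_measurable F \<and> cond_exp_version M F f g"
  unfolding is_cond_exp_def cond_exp_version_def by simp

lemma cond_exp_version_integrable:
  assumes "subalgebra M F" "cond_exp_version M F f g"
  shows "bochner_integrable M f" "bochner_integrable M g" "bochner_integrable (restr_to_subalg M F) g"
  using assms(2) bochner_integrable_restr_to_subalg[OF assms(1), of g]
  unfolding cond_exp_version_def by blast+

lemma cond_exp_version_integral:
  assumes "cond_exp_version M F f g" "A \<in> sets F"
  shows "bochner_integral M (\<lambda>w. indicator A w *\<^sub>R g w) = bochner_integral M (\<lambda>w. indicator A w *\<^sub>R f w)"
  using assms unfolding cond_exp_version_def by blast

lemma cond_exp_version_indicator_integrable:
  assumes "subalgebra M F" "cond_exp_version M F f g" "A \<in> sets F"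
  shows "bochner_integrable M (\<lambda>w. indicator A w *\<^sub>R f w)"
    "bochner_integrable M (\<lambda>w. indicator A w *\<^sub>R g w)"
proof -
  have "A \<in> sets M" using assms(1,3) by (auto simp: subalgebra_def)
  then show "bochner_integrable M (\<lambda>w. indicator A w *\<^sub>R f w)"
    "bochner_integrable M (\<lambda>w. indicator A w *\<^sub>R g w)"
    using bochner_integrable_indicator_scaleR cond_exp_version_integrable(1,2)[OF assms(1,2)] by blast+
qed

lemma cond_exp_version_add:
  assumes sub: "subalgebra M F" and 1: "cond_exp_version M F f g" and 2: "cond_exp_version M F f' g'"
  shows "cond_exp_version M F (\<lambda>w. f w + f' w) (\<lambda>w. g w + g' w)"
proof -
  note int1 = cond_exp_version_integrable[OF sub 1]
  note int2 = cond_exp_version_integrable[OF sub 2]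
  show ?thesis
    unfolding cond_exp_version_def
  proof (intro conjI ballI)
    show "bochner_integrable M (\<lambda>w. f w + f' w)"
      by (rule bochner_integrable_add[OF int1(1) int2(1)])
    show "bochner_integrable (restr_to_subalg M F) (\<lambda>w. g w + g' w)"
      by (rule bochner_integrable_add[OF int1(3) int2(3)])
    fix A assume A: "A \<in> sets F"
    note ind1 = cond_exp_version_indicator_integrable[OF sub 1 A]
    note ind2 = cond_exp_version_indicator_integrable[OF sub 2 A]
    show "bochner_integral M (\<lambda>w. indicator A w *\<^sub>R (g w + g' w))
        = bochner_integral M (\<lambda>w. indicator A w *\<^sub>R (f w + f' w))"
      unfolding scaleR_add_right bochner_integral_add[OF ind1(1) ind2(1)]
        bochner_integral_add[OF ind1(2) ind2(2)] cond_exp_version_integral[OF 1 A]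
        cond_exp_version_integral[OF 2 A] by (rule refl)
  qed
qed

lemma cond_exp_version_bounded_linear:
  assumes sub: "subalgebra M F" and L: "bounded_linear L" and 1: "cond_exp_version M F f g"
  shows "cond_exp_version M F (\<lambda>w. L (f w)) (\<lambda>w. L (g w))"
  unfolding cond_exp_version_def
proof (intro conjI ballI)
  interpret L: bounded_linear L by fact
  note int = cond_exp_version_integrable[OF sub 1]
  show "bochner_integrable M (\<lambda>w. L (f w))"
    by (rule bochner_integrable_bounded_linear[OF L int(1)])
  show "bochner_integrable (restr_to_subalg M F) (\<lambda>w. L (g w))"
    by (rule bochner_integrable_bounded_linear[OF L int(3)])
  fix A assume A: "A \<in> sets F"
  note ind = cond_exp_version_indicator_integrable[OF sub 1 A]
  show "bochner_integral M (\<lambda>w. indicator A w *\<^sub>R L (g w))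
      = bochner_integral M (\<lambda>w. indicator A w *\<^sub>R L (f w))"
    unfolding L.scaleR[symmetric] bochner_integral_bounded_linear[OF L ind(1)]
      bochner_integral_bounded_linear[OF L ind(2)] cond_exp_version_integral[OF 1 A] by (rule refl)
qed

lemma cond_exp_version_diff:
  assumes sub: "subalgebra M F" and 1: "cond_exp_version M F f g" and 2: "cond_exp_version M F f' g'"
  shows "cond_exp_version M F (\<lambda>w. f w - f' w) (\<lambda>w. g w - g' w)"
  using cond_exp_version_add[OF sub 1 cond_exp_version_bounded_linear[OF sub
        bounded_linear_minus[OF bounded_linear_ident] 2]] by simp

lemma cond_exp_version_zero: "cond_exp_version M F (\<lambda>_. 0) (\<lambda>_. 0)"
  unfolding cond_exp_version_def by (simp add: bochner_integrable_zero)

lemma cond_exp_version_sum: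
  assumes sub: "subalgebra M F" and "finite I" "\<And>i. i \<in> I \<Longrightarrow> cond_exp_version M F (f i) (g i)"
  shows "cond_exp_version M F (\<lambda>w. \<Sum>i\<in>I. f i w) (\<lambda>w. \<Sum>i\<in>I. g i w)"
  using assms(2,3)
proof (induction I rule: finite_induct)
  case empty
  show ?case by (simp add: cond_exp_version_zero)
next
  case (insert i I)
  have "cond_exp_version M F (\<lambda>w. f i w + (\<Sum>j\<in>I. f j w)) (\<lambda>w. g i w + (\<Sum>j\<in>I. g j w))"
    by (rule cond_exp_version_add[OF sub]) (use insert in auto)
  then show ?case using insert.hyps by simp
qed

lemma cond_exp_version_cong_AE:
  assumes sub: "subalgebra M F" and 1: "cond_exp_version M F f g"
    and f: "AE w in M. f w = f' w" and g: "AE w in restr_to_subalg M F. g w = g' w"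
  shows "cond_exp_version M F f' g'"
  unfolding cond_exp_version_def
proof (intro conjI ballI)
  show "bochner_integrable M f'" "bochner_integrable (restr_to_subalg M F) g'"
    using bochner_integrable_cong_AE[OF cond_exp_version_integrable(1)[OF sub 1] f]
      bochner_integrable_cong_AE[OF cond_exp_version_integrable(3)[OF sub 1] g] .
  fix A assume A: "A \<in> sets F"
  note int = cond_exp_version_indicator_integrable[OF sub 1 A]
  have "bochner_integral M (\<lambda>w. indicator A w *\<^sub>R f w) = bochner_integral M (\<lambda>w. indicator A w *\<^sub>R f' w)"
    by (rule bochner_integral_cong_AE[OF int(1)], use f in eventually_elim) simp
  moreover have "bochner_integral M (\<lambda>w. indicator A w *\<^sub>R g w) = bochner_integral M (\<lambda>w. indicator A w *\<^sub>R g' w)"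
    by (rule bochner_integral_cong_AE[OF int(2)], use AE_restr_to_subalg[OF sub g] in eventually_elim) simp
  ultimately show "bochner_integral M (\<lambda>w. indicator A w *\<^sub>R g' w) = bochner_integral M (\<lambda>w. indicator A w *\<^sub>R f' w)"
    using cond_exp_version_integral[OF 1 A] by simp
qed

lemma cond_exp_version_limit:
  assumes sub: "subalgebra M F" and fg: "\<And>n. cond_exp_version M F (f n) (g n)"
    and f: "bochner_integrable M f'" "(\<lambda>n. l1_norm M (\<lambda>w. f' w - f n w)) \<longlonglongrightarrow> 0"
    and g: "bochner_integrable (restr_to_subalg M F) g'" "(\<lambda>n. l1_norm M (\<lambda>w. g' w - g n w)) \<longlonglongrightarrow> 0"
  shows "cond_exp_version M F f' g'"
  unfolding cond_exp_version_def
proof (intro conjI ballI f(1) g(1))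
  fix A assume A: "A \<in> sets F"
  then have AM: "A \<in> sets M" using sub by (auto simp: subalgebra_def)
  have "(\<lambda>n. bochner_integral M (\<lambda>w. indicator A w *\<^sub>R f n w))
      \<longlonglongrightarrow> bochner_integral M (\<lambda>w. indicator A w *\<^sub>R f' w)"
    by (intro bochner_integral_indicator_tendsto f AM cond_exp_version_integrable(1)[OF sub fg])
  moreover have "(\<lambda>n. bochner_integral M (\<lambda>w. indicator A w *\<^sub>R g n w))
      \<longlonglongrightarrow> bochner_integral M (\<lambda>w. indicator A w *\<^sub>R g' w)"
    by (intro bochner_integral_indicator_tendsto g(2) AM cond_exp_version_integrable(2)[OF sub fg]
        bochner_integrable_restr_to_subalg[OF sub g(1)])
  ultimately show "bochner_integral M (\<lambda>w. indicator A w *\<^sub>R g' w) = bochner_integral M (\<lambda>w. indicator A w *\<^sub>R f' w)"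
    unfolding cond_exp_version_integral[OF fg A] using LIMSEQ_unique by blast
qed

lemma l1_norm_partition:
  assumes f: "strongly_measurable M f" and t: "simple_function M t"
  shows "(\<Sum>v\<in>t ` space M. l1_norm M (\<lambda>w. indicator {x\<in>space M. t x = v} w *\<^sub>R f w)) = l1_norm M f"
proof -
  obtain u where u: "u \<in> borel_measurable M" "AE w in M. ennreal (norm (f w)) = u w"
    using f by (rule strongly_measurable_norm_modification)
  have fin: "finite (t ` space M)"
    using t by (rule simple_functionD(1))
  have [measurable]: "t \<in> M \<rightarrow>\<^sub>M count_space UNIV"
    using t by (rule measurable_simple_function)
  note [measurable] = u(1)
  let ?A = "\<lambda>v. {x\<in>space M. t x = v}"
  have "l1_norm M (\<lambda>w. indicator (?A v) w *\<^sub>R f w) = (\<integral>\<^sup>+w. indicator (?A v) w * u w \<partial>M)" for v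
    unfolding l1_norm_def
    by (rule nn_integral_cong_AE, use u(2) in eventually_elim) (simp add: indicator_def)
  then have "(\<Sum>v\<in>t ` space M. l1_norm M (\<lambda>w. indicator (?A v) w *\<^sub>R f w))
      = (\<Sum>v\<in>t ` space M. (\<integral>\<^sup>+w. indicator (?A v) w * u w \<partial>M))"
    by simp
  also have "\<dots> = (\<integral>\<^sup>+w. (\<Sum>v\<in>t ` space M. indicator (?A v) w * u w) \<partial>M)"
    by (rule nn_integral_sum[symmetric]) measurable
  also have "\<dots> = (\<integral>\<^sup>+w. u w \<partial>M)"
  proof (rule nn_integral_cong)
    fix w assume w: "w \<in> space M"
    have "(\<Sum>v\<in>t ` space M. indicator (?A v) w * u w) = (\<Sum>v\<in>t ` space M. if t w = v then u w else 0)"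
      using w by (intro sum.cong) (auto simp: indicator_def)
    also have "\<dots> = u w"
      using w fin by simp
    finally show "(\<Sum>v\<in>t ` space M. indicator (?A v) w * u w) = u w" .
  qed
  also have "\<dots> = l1_norm M f"
    unfolding l1_norm_def by (rule nn_integral_cong_AE[symmetric, OF u(2)])
  finally show ?thesis .
qed

text \<open>On a level set of \<open>t\<close> the norm of the integral of \<open>t\<close> is the integral of its norm, and there the
  integral of \<open>g\<close> may be replaced by that of \<open>f\<close>. Summing over the level sets gives the bound.\<close>

lemma cond_exp_version_contraction_aux:
  assumes fin: "finite_measure M" and sub: "subalgebra M F" and fg: "cond_exp_version M F f g"
    and t: "simple_integrable (restr_to_subalg M F) t"
  shows "l1_norm M t \<le> l1_norm M (\<lambda>w. t w - g w) + l1_norm M f"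
proof -
  interpret finite_measure M by fact
  let ?A = "\<lambda>v. {x\<in>space M. t x = v}"
  note sfR = simple_integrable_imp_simple_function[OF t]
  note sf = simple_function_restr_to_subalg[OF sub sfR]
  have AF: "?A v \<in> sets F" for v
  proof -
    have "?A v = t -` {v} \<inter> space (restr_to_subalg M F)"
      by (auto simp: space_restr_to_subalg)
    then show ?thesis
      using simple_functionD(2)[OF sfR] sets_restr_to_subalg[OF sub] by metis
  qed
  then have AM: "?A v \<in> sets M" for v using sub by (auto simp: subalgebra_def)
  have tint: "bochner_integrable M t"
    by (intro bochner_integrable_simple simple_integrable_restr_to_subalg(1)[OF sub t])
  note int = cond_exp_version_integrable[OF sub fg]
  have piece: "l1_norm M (\<lambda>w. indicator (?A v) w *\<^sub>R t w)
      \<le> l1_norm M (\<lambda>w. indicator (?A v) w *\<^sub>R (t w - g w)) + l1_norm M (\<lambda>w. indicator (?A v) w *\<^sub>R f w)"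
    (is "_ \<le> ?a + ?b") for v
  proof -
    have eq: "indicator (?A v) w *\<^sub>R t w = indicator (?A v) w *\<^sub>R v" for w
      by (simp add: indicator_def)
    have "bochner_has_integral M (\<lambda>w. indicator (?A v) w *\<^sub>R v) (measure M (?A v) *\<^sub>R v)"
    proof (rule bochner_has_integral_bounded_linear[OF bounded_linear_scaleR_left])
      show "bochner_has_integral M (indicator (?A v)) (measure M (?A v))"
        using bochner_has_integral_real[of M "indicator (?A v)"] AM[of v] by (simp add: emeasure_eq_measure)
    qed
    then have I: "bochner_integral M (\<lambda>w. indicator (?A v) w *\<^sub>R t w) = measure M (?A v) *\<^sub>R v"
      unfolding eq by (rule bochner_integral_eqI)
    have "l1_norm M (\<lambda>w. indicator (?A v) w *\<^sub>R t w)
        = (\<integral>\<^sup>+w. ennreal (norm v) * indicator (?A v) w \<partial>M)"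
      unfolding l1_norm_def eq by (intro nn_integral_cong) (simp add: indicator_def)
    also have "\<dots> = ennreal (norm (measure M (?A v) *\<^sub>R v))"
      using AM by (simp add: nn_integral_cmult_indicator emeasure_eq_measure ennreal_mult mult.commute)
    also have "measure M (?A v) *\<^sub>R v = bochner_integral M (\<lambda>w. indicator (?A v) w *\<^sub>R (t w - g w))
        + bochner_integral M (\<lambda>w. indicator (?A v) w *\<^sub>R f w)"
      using bochner_integral_diff[OF bochner_integrable_indicator_scaleR[OF tint AM[of v]]
        bochner_integrable_indicator_scaleR[OF int(2) AM[of v]]] I
        cond_exp_version_integral[OF fg AF[of v]]
      by (simp add: scaleR_diff_right)
    also have "ennreal (norm \<dots>) \<le> ennreal (norm (bochner_integral M (\<lambda>w. indicator (?A v) w *\<^sub>R (t w - g w))))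
        + ennreal (norm (bochner_integral M (\<lambda>w. indicator (?A v) w *\<^sub>R f w)))"
      by (simp add: norm_triangle_ineq flip: ennreal_plus)
    also have "\<dots> \<le> ?a + ?b"
      by (intro add_mono norm_bochner_integral_le bochner_integrable_indicator_scaleR
          bochner_integrable_diff tint int AM)
    finally show ?thesis .
  qed
  have sm: "strongly_measurable M t" "strongly_measurable M (\<lambda>w. t w - g w)" "strongly_measurable M f"
    using tint int by (auto intro!: bochner_integrable_imp_strongly_measurable bochner_integrable_diff)
  have "l1_norm M t = (\<Sum>v\<in>t ` space M. l1_norm M (\<lambda>w. indicator (?A v) w *\<^sub>R t w))"
    by (rule l1_norm_partition[OF sm(1) sf, symmetric])
  also have "\<dots> \<le> (\<Sum>v\<in>t ` space M. l1_norm M (\<lambda>w. indicator (?A v) w *\<^sub>R (t w - g w))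
      + l1_norm M (\<lambda>w. indicator (?A v) w *\<^sub>R f w))"
    by (intro sum_mono piece)
  also have "\<dots> = l1_norm M (\<lambda>w. t w - g w) + l1_norm M f"
    unfolding sum.distrib by (simp only: l1_norm_partition[OF sm(2) sf] l1_norm_partition[OF sm(3) sf])
  finally show ?thesis .
qed

lemma cond_exp_version_contraction:
  assumes fin: "finite_measure M" and sub: "subalgebra M F" and fg: "cond_exp_version M F f g"
  shows "l1_norm M g \<le> l1_norm M f"
proof (rule ennreal_le_epsilon)
  fix e :: real assume e: "0 < e"
  note int = cond_exp_version_integrable[OF sub fg]
  obtain t where t: "simple_integrable (restr_to_subalg M F) t"
    "l1_norm (restr_to_subalg M F) (\<lambda>w. g w - t w) < ennreal (e / 2)"
    using bochner_integrable_simple_approx[OF int(3) half_gt_zero[OF e]] by blast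
  have "l1_norm (restr_to_subalg M F) (\<lambda>w. g w - t w) = l1_norm M (\<lambda>w. g w - t w)"
    by (rule l1_norm_restr_to_subalg[OF sub strongly_measurable_diff[OF
        bochner_integrable_imp_strongly_measurable[OF int(3)]
        simple_integrable_imp_strongly_measurable[OF t(1)]]])
  with t(2) have gt: "l1_norm M (\<lambda>w. g w - t w) \<le> ennreal (e / 2)" by simp
  have "l1_norm M g \<le> l1_norm M (\<lambda>w. g w - t w) + l1_norm M t"
    by (rule l1_norm_triangle[OF bochner_integrable_imp_strongly_measurable[OF int(2)]
        simple_integrable_imp_strongly_measurable[OF simple_integrable_restr_to_subalg(1)[OF sub t(1)]]])
  also have "\<dots> \<le> ennreal (e / 2) + (ennreal (e / 2) + l1_norm M f)"
  proof (rule add_mono[OF gt])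
    show "l1_norm M t \<le> ennreal (e / 2) + l1_norm M f"
      using cond_exp_version_contraction_aux[OF fin sub fg t(1)] add_right_mono[OF gt]
      unfolding l1_norm_minus_commute[of M t g] by (rule order_trans)
  qed
  also have "\<dots> = l1_norm M f + ennreal e"
  proof -
    have "ennreal e = ennreal (e / 2) + ennreal (e / 2)"
      using e by (simp flip: ennreal_plus)
    then show ?thesis by (simp only: ac_simps)
  qed
  finally show "l1_norm M g \<le> l1_norm M f + ennreal e" .
qed

lemma cond_exp_version_unique:
  assumes fin: "finite_measure M" and sub: "subalgebra M F"
    and 1: "cond_exp_version M F f g" and 2: "cond_exp_version M F f g'"
  shows "AE w in M. g w = g' w"
proof -
  note d = cond_exp_version_diff[OF sub 1 2]
  have "l1_norm M (\<lambda>w. g w - g' w) = 0"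
    using cond_exp_version_contraction[OF fin sub d] by simp
  then have "AE w in M. g w - g' w = 0"
    by (rule l1_norm_eq_0_AE[OF bochner_integrable_imp_strongly_measurable[OF
          cond_exp_version_integrable(2)[OF sub d]]])
  then show ?thesis by simp
qed

section \<open>Existence, with values in a closed convex set\<close>

lemma cond_exp_version_real:
  fixes u :: "'a \<Rightarrow> real"
  assumes fin: "finite_measure M" and sub: "subalgebra M F" and u: "integrable M u"
  shows "cond_exp_version M F u (real_cond_exp M F u)"
  unfolding cond_exp_version_def
proof (intro conjI ballI)
  interpret finite_measure M by fact
  interpret finite_measure_subalgebra M F by unfold_locales (rule sub)
  note v = real_cond_exp_int(1)[OF u]
  show "bochner_integrable M u"
    unfolding bochner_integrable_def using bochner_has_integral_real[OF u] by blast
  have "integrable (restr_to_subalg M F) (real_cond_exp M F u)"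
    by (rule integrable_in_subalg[OF sub borel_measurable_cond_exp v])
  then show "bochner_integrable (restr_to_subalg M F) (real_cond_exp M F u)"
    unfolding bochner_integrable_def using bochner_has_integral_real by blast
  fix A assume A: "A \<in> sets F"
  then have AM: "A \<in> sets M" using sub by (auto simp: subalgebra_def)
  have I: "bochner_integral M (\<lambda>w. indicator A w *\<^sub>R h w) = (\<integral>w\<in>A. h w \<partial>M)"
    if "integrable M h" for h :: "'a \<Rightarrow> real"
    unfolding set_lebesgue_integral_def
    by (rule bochner_integral_eqI[OF bochner_has_integral_real[OF integrable_mult_indicator[OF AM that]]])
  show "bochner_integral M (\<lambda>w. indicator A w *\<^sub>R real_cond_exp M F u w)
      = bochner_integral M (\<lambda>w. indicator A w *\<^sub>R u w)"
    unfolding I[OF u] I[OF v] by (rule real_cond_exp_intA[OF u A, symmetric])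
qed

lemma cond_exp_version_simple_convex:
  fixes s :: "'a \<Rightarrow> 'b::banach"
  assumes prob: "prob_space M" and sub: "subalgebra M F" and s: "simple_function M s"
    and C: "convex C" "\<And>w. w \<in> space M \<Longrightarrow> s w \<in> C"
  obtains g where "cond_exp_version M F s g" "AE w in M. g w \<in> C"
proof -
  interpret prob_space M by fact
  interpret finite_measure_subalgebra M F by unfold_locales (rule sub)
  define V where "V = s ` space M"
  define A where "A v = {w\<in>space M. s w = v}" for v
  define p where "p v = real_cond_exp M F (indicator (A v))" for v
  have finV: "finite V" unfolding V_def using s by (rule simple_functionD(1))
  have AM: "A v \<in> sets M" for v
  proof -
    have "A v = s -` {v} \<inter> space M" unfolding A_def by auto
    then show ?thesis using simple_functionD(2)[OF s] by metis
  qed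
  have intA: "integrable M (indicator (A v) :: 'a \<Rightarrow> real)" for v
    using AM by (simp add: emeasure_eq_measure)
  have "cond_exp_version M F (\<lambda>w. \<Sum>v\<in>V. indicator (A v) w *\<^sub>R v) (\<lambda>w. \<Sum>v\<in>V. p v w *\<^sub>R v)"
  proof (rule cond_exp_version_sum[OF sub finV])
    fix v
    show "cond_exp_version M F (\<lambda>w. indicator (A v) w *\<^sub>R v) (\<lambda>w. p v w *\<^sub>R v)"
      unfolding p_def
      by (rule cond_exp_version_bounded_linear[OF sub bounded_linear_scaleR_left
            cond_exp_version_real[OF finite_measure_axioms sub intA]])
  qed
  moreover have "AE w in M. (\<Sum>v\<in>V. indicator (A v) w *\<^sub>R v) = s w"
  proof (rule AE_I2)
    fix w assume w: "w \<in> space M"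
    have "(\<Sum>v\<in>V. indicator (A v) w *\<^sub>R v) = (\<Sum>v\<in>V. if s w = v then v else 0)"
      using w by (intro sum.cong) (auto simp: indicator_def A_def)
    also have "\<dots> = s w"
      using w finV by (simp add: V_def)
    finally show "(\<Sum>v\<in>V. indicator (A v) w *\<^sub>R v) = s w" .
  qed
  ultimately have ver: "cond_exp_version M F s (\<lambda>w. \<Sum>v\<in>V. p v w *\<^sub>R v)"
    by (rule cond_exp_version_cong_AE[OF sub]) simp
  \<comment> \<open>the conditional probabilities \<open>p v\<close> are almost surely convex weights\<close>
  have "AE w in M. 0 \<le> p v w" for v
    unfolding p_def using AM by (intro real_cond_exp_pos) auto
  then have pos: "AE w in M. \<forall>v\<in>V. 0 \<le> p v w"
    using finV by (intro AE_finite_allI)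
  have "AE w in M. real_cond_exp M F (\<lambda>w. \<Sum>v\<in>V. indicator (A v) w) w = (\<Sum>v\<in>V. p v w)"
    unfolding p_def by (rule real_cond_exp_sum[OF intA])
  moreover have "AE w in M. real_cond_exp M F (\<lambda>w. \<Sum>v\<in>V. indicator (A v) w) w
      = real_cond_exp M F (\<lambda>_. 1) w"
  proof (rule real_cond_exp_cong)
    show "AE w in M. (\<Sum>v\<in>V. indicator (A v) w) = (1::real)"
    proof (rule AE_I2)
      fix w assume w: "w \<in> space M"
      have "(\<Sum>v\<in>V. indicator (A v) w) = (\<Sum>v\<in>V. if s w = v then 1 else 0 :: real)"
        using w by (intro sum.cong) (auto simp: indicator_def A_def)
      also have "\<dots> = 1"
        using w finV by (simp add: V_def)
      finally show "(\<Sum>v\<in>V. indicator (A v) w) = (1::real)" .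
    qed
  qed (use AM in auto)
  moreover have "AE w in M. real_cond_exp M F (\<lambda>_. 1) w = 1"
    by (rule real_cond_exp_F_meas) auto
  ultimately have one: "AE w in M. (\<Sum>v\<in>V. p v w) = 1"
    by eventually_elim simp
  have "AE w in M. (\<Sum>v\<in>V. p v w *\<^sub>R v) \<in> C"
    using pos one
  proof eventually_elim
    case (elim w)
    show ?case
      using elim C(2) by (intro convex_sum[OF finV C(1)]) (auto simp: V_def)
  qed
  with ver show ?thesis by (rule that)
qed

text \<open>A simple \<open>L\<^sup>1\<close> approximation \<open>t\<close> of \<open>Z\<close> is composed with a map \<open>c\<close> sending each point to a
  nearly closest point of \<open>C\<close>. Since \<open>t\<close> has finitely many values, no measurability of \<open>c\<close> is
  needed.\<close>

lemma simple_approx_in_set: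
  fixes Z :: "'a \<Rightarrow> 'b::banach"
  assumes prob: "prob_space M" and Z: "bochner_integrable M Z" "\<And>w. w \<in> space M \<Longrightarrow> Z w \<in> C"
    and e: "0 < e"
  obtains s where "simple_function M s" "\<And>w. s w \<in> C" "l1_norm M (\<lambda>w. Z w - s w) \<le> ennreal e"
proof -
  interpret prob_space M by fact
  have ne: "C \<noteq> {}" using Z(2) not_empty by blast
  \<comment> \<open>the final error is at most twice that of \<open>t\<close> plus the slack in the choice of \<open>c\<close>\<close>
  have e4: "0 < e / 4" using e by simp
  obtain t where t: "simple_integrable M t" "l1_norm M (\<lambda>w. Z w - t w) < ennreal (e / 4)"
    using bochner_integrable_simple_approx[OF Z(1) e4] by blast
  have "\<exists>c\<in>C. dist v c < infdist v C + e / 4" for v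
  proof (rule ccontr)
    assume "\<not> (\<exists>c\<in>C. dist v c < infdist v C + e / 4)"
    then have "infdist v C + e / 4 \<le> infdist v C"
      unfolding infdist_notempty[OF ne] by (intro cINF_greatest ne) (auto simp: not_less)
    then show False using e by simp
  qed
  then obtain c where c: "\<And>v. c v \<in> C" "\<And>v. dist v (c v) < infdist v C + e / 4"
    by metis
  show ?thesis
  proof (rule that)
    show "simple_function M (\<lambda>w. c (t w))"
      by (rule simple_function_compose1[OF simple_integrable_imp_simple_function[OF t(1)]])
    show "c (t w) \<in> C" for w by (rule c(1))
    have smZ: "strongly_measurable M (\<lambda>w. Z w - t w)"
      by (rule strongly_measurable_diff[OF bochner_integrable_imp_strongly_measurable[OF Z(1)]
            simple_integrable_imp_strongly_measurable[OF t(1)]])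
    have smc: "strongly_measurable M (\<lambda>w. norm (Z w - t w) + e / 4)"
      by (rule strongly_measurable_compose[OF smZ]) (intro continuous_intros)
    have smn: "strongly_measurable M (\<lambda>w. norm (Z w - t w))"
      by (rule strongly_measurable_compose[OF smZ]) (intro continuous_intros)
    have smk: "strongly_measurable M (\<lambda>w. e / 4)"
      by (rule strongly_measurable_simple_function) simp
    have n: "l1_norm M (\<lambda>w. norm (Z w - t w)) = l1_norm M (\<lambda>w. Z w - t w)"
      unfolding l1_norm_def by simp
    have k: "l1_norm M (\<lambda>w. e / 4) = ennreal (e / 4)"
      unfolding l1_norm_def using e by (simp add: emeasure_space_1)
    \<comment> \<open>as \<open>Z w\<close> lies in \<open>C\<close>, the value \<open>t w\<close> is at least as close to \<open>C\<close> as to \<open>Z w\<close>\<close>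
    have "l1_norm M (\<lambda>w. Z w - c (t w)) \<le> l1_norm M (\<lambda>w. norm (Z w - t w) + (norm (Z w - t w) + e / 4))"
    proof (rule l1_norm_mono_AE, rule AE_I2)
      fix w assume "w \<in> space M"
      then have "infdist (t w) C \<le> dist (t w) (Z w)"
        by (intro infdist_le Z(2))
      then have "dist (Z w) (c (t w)) \<le> dist (Z w) (t w) + (dist (Z w) (t w) + e / 4)"
        using dist_triangle[of "Z w" "c (t w)" "t w"] c(2)[of "t w"] by (simp add: dist_commute)
      then show "norm (Z w - c (t w)) \<le> norm (norm (Z w - t w) + (norm (Z w - t w) + e / 4))"
        using e by (simp add: dist_norm)
    qed
    also have "\<dots> \<le> l1_norm M (\<lambda>w. Z w - t w) + (l1_norm M (\<lambda>w. Z w - t w) + ennreal (e / 4))"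
      using order_trans[OF l1_norm_add_le[OF smn smc] add_left_mono[OF l1_norm_add_le[OF smn smk]]]
      unfolding n k .
    also have "\<dots> \<le> ennreal (e / 4) + (ennreal (e / 4) + ennreal (e / 4))"
      using t(2) by (intro add_mono order_refl less_imp_le)
    also have "\<dots> = ennreal (e / 4 + (e / 4 + e / 4))"
      using e by (simp flip: ennreal_plus)
    also have "\<dots> \<le> ennreal e"
      using e by (intro ennreal_leI) simp
    finally show "l1_norm M (\<lambda>w. Z w - c (t w)) \<le> ennreal e" .
  qed
qed

lemma cond_exp_in_closed_convex:
  fixes Z :: "'a \<Rightarrow> 'b::banach"
  assumes prob: "prob_space M" and sub: "subalgebra M F"
    and Z: "bochner_integrable M Z" "\<And>w. w \<in> space M \<Longrightarrow> Z w \<in> C"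
    and C: "convex C" "closed C"
  obtains g where "g \<in> borel_measurable F" "cond_exp_version M F Z g" "AE w in M. g w \<in> C"
proof -
  interpret prob_space M by fact
  let ?R = "restr_to_subalg M F"
  have "\<exists>s. simple_function M s \<and> (\<forall>w. s w \<in> C) \<and> l1_norm M (\<lambda>w. Z w - s w) \<le> ennreal ((1 / 2) ^ n)" for n
    by (rule simple_approx_in_set[OF prob Z, of "(1 / 2) ^ n"]) auto
  then obtain s where s: "\<And>n. simple_function M (s n)" "\<And>n w. s n w \<in> C"
    "\<And>n. l1_norm M (\<lambda>w. Z w - s n w) \<le> ennreal ((1 / 2) ^ n)" by metis
  have "\<exists>g. cond_exp_version M F (s n) g \<and> (AE w in M. g w \<in> C)" for n
    by (rule cond_exp_version_simple_convex[OF prob sub s(1)[of n] C(1) s(2)]) blast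
  then obtain g where g: "\<And>n. cond_exp_version M F (s n) (g n)" "\<And>n. AE w in M. g n w \<in> C"
    by metis
  note int = cond_exp_version_integrable[OF sub g(1)]
  have smZ: "strongly_measurable M Z"
    by (rule bochner_integrable_imp_strongly_measurable[OF Z(1)])
  have sms: "strongly_measurable M (s n)" for n
    by (rule strongly_measurable_simple_function[OF s(1)])
  have step: "l1_norm ?R (\<lambda>w. g (Suc n) w - g n w) \<le> ennreal (2 * (1 / 2) ^ n)" for n
  proof -
    have "l1_norm ?R (\<lambda>w. g (Suc n) w - g n w) = l1_norm M (\<lambda>w. g (Suc n) w - g n w)"
      by (rule l1_norm_restr_to_subalg[OF sub bochner_integrable_imp_strongly_measurable[OF
              bochner_integrable_diff[OF int(3) int(3)]]])
    also have "\<dots> \<le> l1_norm M (\<lambda>w. s (Suc n) w - s n w)"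
      by (rule cond_exp_version_contraction[OF finite_measure_axioms sub
            cond_exp_version_diff[OF sub g(1) g(1)]])
    also have "\<dots> \<le> l1_norm M (\<lambda>w. s (Suc n) w - Z w) + l1_norm M (\<lambda>w. Z w - s n w)"
      by (rule l1_norm_diff_triangle[OF sms smZ sms])
    also have "\<dots> \<le> ennreal ((1 / 2) ^ Suc n) + ennreal ((1 / 2) ^ n)"
      unfolding l1_norm_minus_commute[of M "s (Suc n)" Z] by (rule add_mono[OF s(3) s(3)])
    also have "\<dots> = ennreal ((1 / 2) ^ Suc n + (1 / 2) ^ n)"
      by (rule ennreal_plus[symmetric]) simp_all
    also have "\<dots> \<le> ennreal (2 * (1 / 2) ^ n)"
      by (rule ennreal_leI) simp
    finally show ?thesis .
  qed
  have summ: "summable (\<lambda>n. 2 * (1 / 2) ^ n :: real)"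
    by (intro summable_mult summable_geometric) simp
  obtain h where h: "bochner_integrable ?R h" "AE w in ?R. (\<lambda>n. g n w) \<longlonglongrightarrow> h w"
    "(\<lambda>n. l1_norm ?R (\<lambda>w. h w - g n w)) \<longlonglongrightarrow> 0"
    by (rule l1_complete[OF int(3) summ _ step]) simp_all
  have "l1_norm ?R (\<lambda>w. h w - g n w) = l1_norm M (\<lambda>w. h w - g n w)" for n
    by (rule l1_norm_restr_to_subalg[OF sub bochner_integrable_imp_strongly_measurable[OF
            bochner_integrable_diff[OF h(1) int(3)]]])
  with h(3) have hg: "(\<lambda>n. l1_norm M (\<lambda>w. h w - g n w)) \<longlonglongrightarrow> 0"
    by simp
  have Zs: "(\<lambda>n. l1_norm M (\<lambda>w. Z w - s n w)) \<longlonglongrightarrow> 0"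
  proof (rule tendsto_sandwich[OF _ _ tendsto_const])
    have "(\<lambda>n. ennreal ((1 / 2) ^ n)) \<longlonglongrightarrow> ennreal 0"
      by (intro tendsto_ennrealI LIMSEQ_power_zero) simp
    then show "(\<lambda>n. ennreal ((1 / 2) ^ n)) \<longlonglongrightarrow> 0" by simp
  qed (simp_all add: s(3))
  have ver: "cond_exp_version M F Z h"
    by (rule cond_exp_version_limit[OF sub g(1) Z(1) Zs h(1) hg])
  have "AE w in M. \<forall>n. g n w \<in> C"
    using g(2) by (simp add: AE_all_countable)
  then have hC: "AE w in M. h w \<in> C"
    using AE_restr_to_subalg[OF sub h(2)]
  proof eventually_elim
    case (elim w)
    then show ?case using closed_sequentially[OF C(2), of "\<lambda>n. g n w" "h w"] by blast
  qed
  \<comment> \<open>\<open>h\<close> is only strongly measurable with respect to \<open>F\<close>\<close>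
  obtain h' where h': "h' \<in> borel_measurable ?R" "AE w in ?R. h w = h' w"
    by (rule strongly_measurable_borel_modification[OF bochner_integrable_imp_strongly_measurable[OF h(1)]])
  show ?thesis
  proof (rule that)
    show "h' \<in> borel_measurable F"
      by (rule measurable_in_subalg'[OF sub h'(1)])
    show "cond_exp_version M F Z h'"
      by (rule cond_exp_version_cong_AE[OF sub ver _ h'(2)]) simp
    show "AE w in M. h' w \<in> C"
      using hC AE_restr_to_subalg[OF sub h'(2)] by eventually_elim simp
  qed
qed

text \<open>The choice made by \<^const>\<open>bochner_cond_exp\<close> agrees almost everywhere with any Borel measurable
  version, once there is one.\<close>

lemma bochner_cond_exp_AE_eq:
  assumes "finite_measure M" "subalgebra M F" "g \<in> borel_measurable F" "cond_exp_version M F f g"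
  shows "AE w in M. bochner_cond_exp M F f w = g w"
proof -
  have f: "bochner_integrable M f"
    using assms(4) unfolding cond_exp_version_def by blast
  have "is_cond_exp M F f g"
    using assms(3,4) is_cond_exp_iff_cond_exp_version[OF f] by blast
  then have "is_cond_exp M F f (bochner_cond_exp M F f)"
    unfolding bochner_cond_exp_def by (rule someI[of "is_cond_exp M F f"])
  then have "cond_exp_version M F f (bochner_cond_exp M F f)"
    using is_cond_exp_iff_cond_exp_version[OF f] by blast
  then show ?thesis
    by (rule cond_exp_version_unique[OF assms(1,2) _ assms(4)])
qed

theorem theorem5p5:
  fixes M F :: "'a measure"
    and K :: "'x::banach set"
    and f :: "'x \<Rightarrow> 'y::banach"
    and X :: "'a \<Rightarrow> 'x"
    and le :: "'y \<Rightarrow> 'y \<Rightarrow> bool"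
    and le' :: "'y extended \<Rightarrow> 'y extended \<Rightarrow> bool"
    and gl gu :: "'x \<Rightarrow> 'y extended"
  assumes "prob_space M"
    and "subalgebra M F"
    and "extends_rel le le'"
    and "X \<in> M \<rightarrow>\<^sub>M restrict_space borel K"
    and "bochner_integrable M (\<lambda>w. (X w, f (X w)))"
    and "closure (convex hull (graph_on K f)) \<subseteq>
           {(x, y). x \<in> closure (convex hull K) \<and> le' (gl x) (Fin y) \<and> le' (Fin y) (gu x)}"
  shows "AE w in M.
           bochner_cond_exp M F X w \<in> closure (convex hull K) \<and>
           le' (gl (bochner_cond_exp M F X w)) (Fin (bochner_cond_exp M F (\<lambda>v. f (X v)) w)) \<and>
           le' (Fin (bochner_cond_exp M F (\<lambda>v. f (X v)) w)) (gu (bochner_cond_exp M F X w))"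
proof -
  interpret prob_space M by fact
  let ?C = "closure (convex hull (graph_on K f))"
  have in_C: "(X w, f (X w)) \<in> ?C" if "w \<in> space M" for w
  proof -
    have "X w \<in> K"
      using measurable_space[OF assms(4) that] by (simp add: space_restrict_space)
    then have "(X w, f (X w)) \<in> graph_on K f"
      unfolding graph_on_def by blast
    then show ?thesis
      by (rule subsetD[OF closure_subset hull_inc])
  qed
  obtain g where g: "g \<in> borel_measurable F"
      "cond_exp_version M F (\<lambda>w. (X w, f (X w))) g" "AE w in M. g w \<in> ?C"
    by (rule cond_exp_in_closed_convex[OF assms(1,2,5) in_C convex_closure[OF convex_convex_hull] closed_closure])
  have meas: "(\<lambda>w. fst (g w)) \<in> borel_measurable F" "(\<lambda>w. snd (g w)) \<in> borel_measurable F"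
    by (intro measurable_compose[OF g(1)] borel_measurable_continuous_onI continuous_intros)+
  have "cond_exp_version M F X (\<lambda>w. fst (g w))"
    using cond_exp_version_bounded_linear[OF assms(2) bounded_linear_fst g(2)] by simp
  then have 1: "AE w in M. bochner_cond_exp M F X w = fst (g w)"
    by (rule bochner_cond_exp_AE_eq[OF finite_measure_axioms assms(2) meas(1)])
  have "cond_exp_version M F (\<lambda>w. f (X w)) (\<lambda>w. snd (g w))"
    using cond_exp_version_bounded_linear[OF assms(2) bounded_linear_snd g(2)] by simp
  then have 2: "AE w in M. bochner_cond_exp M F (\<lambda>w. f (X w)) w = snd (g w)"
    by (rule bochner_cond_exp_AE_eq[OF finite_measure_axioms assms(2) meas(2)])
  show ?thesis
    using g(3) 1 2
  proof eventually_elim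
    case (elim w)
    then show ?case using subsetD[OF assms(6) elim(1)] by (simp add: case_prod_beta)
  qed
qed

end
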